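(* Let $\Omega\subset\mathbb{R}^d$ be a bounded $C^2$ domain equipped with heterogeneous localization functions $\eta_\delta$, $0<\delta<\delta_0$, and let $\rho$ be an admissible, normalized kernel (as defined in the context). Then there exists a constant $C=C(\Omega,\delta_0)$ such that for all $\delta\in(0,\delta_0)$ $$[u]_{\mathfrak{W}^{\delta,2}(\Omega)}\le C\|\nabla u\|_{L^2(\Omega)}\qquad\text{for all }u\in H^1(\Omega).$$
   Context: Domain and localization functions. $\Omega\subset\mathbb{R}^d$ is a bounded $C^2$ domain. There are constants $\kappa_0\in(0,1)$ and $\kappa_1,\kappa_2,\bar\kappa_0>0$ depending at most on $d$ and $\Omega$ and, with $\delta_0:=\min\{1,\frac{1}{9\kappa_1^2},\frac{1}{2\bar\kappa_0^2}\}$, for every $0<\delta<\delta_0$ a function $\eta_\delta:\overline\Omega\to[0,\infty)$, positive in $\Omega$, such that: (i) $\eta_\delta(x)=\operatorname{dist}(x,\partial\Omega)^2$ for $x\in\Omega$ with $\operatorname{dist}(x,\partial\Omega)^2<\kappa_0\delta$; (ii) $\eta_\delta(x)=\delta$ for $x\in\Omega$ with $\kappa_0\operatorname{dist}(x,\partial\Omega)^2>\delta$; (iii) $\eta_\delta\in C^2(\overline\Omega)$ with $|\nabla\eta_\delta|\le\kappa_1\sqrt\delta$ and $|\nabla^2\eta_\delta|\le\kappa_2$ in $\Omega$; (iv) $\eta_\delta(x)\le\bar\kappa_0\min\{\delta,\operatorname{dist}(x,\partial\Omega)^2\}$ in $\Omega$. These data are fixed with $\Omega$; a constant "depending on $\Omega$"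 may depend on $\kappa_0,\kappa_1,\kappa_2,\bar\kappa_0$ but not on $\delta$. Kernel. $\rho:[0,\infty)\to[0,\infty)$ is admissible if there are constants $0<\rho_0<\infty$ and $0<r_0<R_0<1$ such that $\rho\in C^1([0,\infty))$, $\rho\ge0$, $\lim_{r\to0^+}\rho'(r)/r$ exists, $\operatorname{supp}\rho\subset[0,R_0)$, and $\rho(r)\ge\rho_0$ for all $r\in[0,r_0]$. It is normalized if $\int_{B(0,1)}|z|^2\rho(|z|)\,dz=d$. Seminorm. Fix a constant $R\in(0,1)$ (constants may depend on this fixed choice). $[u]_{\mathfrak{W}^{\delta,2}(\Omega)}^2:=\int_\Omega\int_{\Omega\cap\{|y-x|\le R\eta_\delta(x)\}}\frac{|u(x)-u(y)|^2}{\eta_\delta(x)^{d+2}}\,dy\,dx$. *)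

theory Defs
  imports "HOL-Analysis.Analysis"
begin

definition partial_deriv :: "'a::euclidean_space \<Rightarrow> ('a \<Rightarrow> real) \<Rightarrow> 'a \<Rightarrow> real" where
  "partial_deriv i f x = frechet_derivative f (at x) i"

definition grad :: "('a::euclidean_space \<Rightarrow> real) \<Rightarrow> 'a \<Rightarrow> 'a" where
  "grad f x = (\<Sum>i\<in>Basis. partial_deriv i f x *\<^sub>R i)"

text \<open>The Hessian as a linear map, so that its norm below is the operator norm.\<close>

definition hessian :: "('a::euclidean_space \<Rightarrow> real) \<Rightarrow> 'a \<Rightarrow> 'a \<Rightarrow> 'a" where
  "hessian f x = frechet_derivative (grad f) (at x)"

text \<open>\<open>Ck_on k S\<close> is meant for open \<open>S\<close>.\<close>

primrec Ck_on :: "nat \<Rightarrow> 'a::euclidean_space set \<Rightarrow> ('a \<Rightarrow> real) \<Rightarrow> bool" where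
  "Ck_on 0 S f \<longleftrightarrow> continuous_on S f"
| "Ck_on (Suc k) S f \<longleftrightarrow>
     (\<forall>x\<in>S. f differentiable at x) \<and> (\<forall>i\<in>Basis. Ck_on k S (partial_deriv i f))"

text \<open>
  \<open>Ck_closure k S f\<close> says that all partial derivatives of \<open>f\<close> of order at most \<open>k\<close> exist in
  the open set \<open>S\<close> and extend continuously to \<open>closure S\<close>. Only the values of \<open>f\<close> in \<open>S\<close> matter.
\<close>

primrec Ck_closure :: "nat \<Rightarrow> 'a::euclidean_space set \<Rightarrow> ('a \<Rightarrow> real) \<Rightarrow> bool" where
  "Ck_closure 0 S f \<longleftrightarrow> (\<exists>g. continuous_on (closure S) g \<and> (\<forall>x\<in>S. g x = f x))"
| "Ck_closure (Suc k) S f \<longleftrightarrow>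
     (\<exists>g. continuous_on (closure S) g \<and> (\<forall>x\<in>S. g x = f x)) \<and>
     (\<forall>x\<in>S. f differentiable at x) \<and> (\<forall>i\<in>Basis. Ck_closure k S (partial_deriv i f))"

text \<open>
  Near each boundary point, \<open>\<Omega>\<close> is the part above the graph of a \<open>C\<^sup>2\<close> function over the
  hyperplane orthogonal to some unit vector \<open>e\<close>. The function \<open>\<gamma>\<close> is defined on the whole space
  but evaluated only on that hyperplane.
\<close>

definition bounded_C2_domain :: "'a::euclidean_space set \<Rightarrow> bool" where
  "bounded_C2_domain \<Omega> \<longleftrightarrow>
     open \<Omega> \<and> connected \<Omega> \<and> \<Omega> \<noteq> {} \<and> bounded \<Omega> \<and>
     (\<forall>p\<in>frontier \<Omega>. \<exists>r>0. \<exists>e \<gamma>. norm e = 1 \<and> Ck_on 2 UNIV \<gamma> \<and>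
        \<Omega> \<inter> ball p r = {x \<in> ball p r. \<gamma> (x - (x \<bullet> e) *\<^sub>R e) < x \<bullet> e})"

definition delta0 :: "real \<Rightarrow> real \<Rightarrow> real" where
  "delta0 \<kappa>\<^sub>1 \<kappa>b\<^sub>0 = Min {1, 1 / (9 * \<kappa>\<^sub>1\<^sup>2), 1 / (2 * \<kappa>b\<^sub>0\<^sup>2)}"

definition localization_family ::
    "'a::euclidean_space set \<Rightarrow> real \<Rightarrow> real \<Rightarrow> real \<Rightarrow> real \<Rightarrow> (real \<Rightarrow> 'a \<Rightarrow> real) \<Rightarrow> bool" where
  "localization_family \<Omega> \<kappa>\<^sub>0 \<kappa>\<^sub>1 \<kappa>\<^sub>2 \<kappa>b\<^sub>0 \<eta> \<longleftrightarrow>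
     (\<forall>\<delta>. 0 < \<delta> \<and> \<delta> < delta0 \<kappa>\<^sub>1 \<kappa>b\<^sub>0 \<longrightarrow>
        (\<forall>x\<in>closure \<Omega>. 0 \<le> \<eta> \<delta> x) \<and>
        (\<forall>x\<in>\<Omega>. 0 < \<eta> \<delta> x) \<and>
        (\<forall>x\<in>\<Omega>. (infdist x (frontier \<Omega>))\<^sup>2 < \<kappa>\<^sub>0 * \<delta> \<longrightarrow> \<eta> \<delta> x = (infdist x (frontier \<Omega>))\<^sup>2) \<and>
        (\<forall>x\<in>\<Omega>. \<kappa>\<^sub>0 * (infdist x (frontier \<Omega>))\<^sup>2 > \<delta> \<longrightarrow> \<eta> \<delta> x = \<delta>) \<and>
        continuous_on (closure \<Omega>) (\<eta> \<delta>) \<and>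
        Ck_closure 2 \<Omega> (\<eta> \<delta>) \<and>
        (\<forall>x\<in>\<Omega>. norm (grad (\<eta> \<delta>) x) \<le> \<kappa>\<^sub>1 * sqrt \<delta>) \<and>
        (\<forall>x\<in>\<Omega>. onorm (hessian (\<eta> \<delta>) x) \<le> \<kappa>\<^sub>2) \<and>
        (\<forall>x\<in>\<Omega>. \<eta> \<delta> x \<le> \<kappa>b\<^sub>0 * min \<delta> ((infdist x (frontier \<Omega>))\<^sup>2)))"

text \<open>A kernel is a function on \<open>[0,\<infinity>)\<close>; its values at negative arguments are irrelevant.\<close>

definition admissible_kernel :: "(real \<Rightarrow> real) \<Rightarrow> bool" where
  "admissible_kernel \<rho> \<longleftrightarrow>
     (\<exists>\<rho>\<^sub>0 r\<^sub>0 R\<^sub>0. 0 < \<rho>\<^sub>0 \<and> 0 < r\<^sub>0 \<and> r\<^sub>0 < R\<^sub>0 \<and> R\<^sub>0 < 1 \<and>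
        (\<forall>r\<ge>0. 0 \<le> \<rho> r) \<and>
        (\<exists>\<rho>'. continuous_on {0..} \<rho>' \<and>
              (\<forall>r\<ge>0. (\<rho> has_real_derivative \<rho>' r) (at r within {0..})) \<and>
              (\<exists>L. ((\<lambda>r. \<rho>' r / r) \<longlongrightarrow> L) (at_right 0))) \<and>
        closure {r. 0 \<le> r \<and> \<rho> r \<noteq> 0} \<subseteq> {0..<R\<^sub>0} \<and>
        (\<forall>r\<in>{0..r\<^sub>0}. \<rho>\<^sub>0 \<le> \<rho> r))"

definition normalized_kernel :: "'a::euclidean_space itself \<Rightarrow> (real \<Rightarrow> real) \<Rightarrow> bool" where
  "normalized_kernel _ \<rho> \<longleftrightarrow>
     (LINT z:ball (0::'a) 1|lebesgue. (norm z)\<^sup>2 * \<rho> (norm z)) = real DIM('a)"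

text \<open>
  Norms are taken in \<open>[0,\<infinity>]\<close>, so that an inequality between them includes the finiteness of the
  left-hand side when the right-hand side is finite.
\<close>

definition ennsqrt :: "ennreal \<Rightarrow> ennreal" where
  "ennsqrt a = (if a = \<infinity> then \<infinity> else ennreal (sqrt (enn2real a)))"

definition L2norm :: "'a::euclidean_space set \<Rightarrow> ('a \<Rightarrow> 'b::real_normed_vector) \<Rightarrow> ennreal" where
  "L2norm \<Omega> f = ennsqrt (\<integral>\<^sup>+x\<in>\<Omega>. ennreal ((norm (f x))\<^sup>2) \<partial>lebesgue)"

definition L2_space :: "'a::euclidean_space set \<Rightarrow> ('a \<Rightarrow> 'b::real_normed_vector) set" where
  "L2_space \<Omega> = {f. f \<in> borel_measurable (lebesgue_on \<Omega>) \<and> L2norm \<Omega> f < \<infinity>}"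

definition test_functions :: "'a::euclidean_space set \<Rightarrow> ('a \<Rightarrow> real) set" where
  "test_functions \<Omega> =
     {\<phi>. (\<forall>k. Ck_on k UNIV \<phi>) \<and> compact (closure {x. \<phi> x \<noteq> 0}) \<and> closure {x. \<phi> x \<noteq> 0} \<subseteq> \<Omega>}"

definition locally_integrable ::
    "'a::euclidean_space set \<Rightarrow> ('a \<Rightarrow> 'b::euclidean_space) \<Rightarrow> bool" where
  "locally_integrable \<Omega> f \<longleftrightarrow> (\<forall>K. compact K \<and> K \<subseteq> \<Omega> \<longrightarrow> set_integrable lebesgue K f)"

definition weak_gradient ::
    "'a::euclidean_space set \<Rightarrow> ('a \<Rightarrow> real) \<Rightarrow> ('a \<Rightarrow> 'a) \<Rightarrow> bool" where
  "weak_gradient \<Omega> u g \<longleftrightarrow>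
     locally_integrable \<Omega> u \<and> locally_integrable \<Omega> g \<and>
     (\<forall>\<phi>\<in>test_functions \<Omega>. \<forall>i\<in>Basis.
        (LINT x:\<Omega>|lebesgue. u x * partial_deriv i \<phi> x) = - (LINT x:\<Omega>|lebesgue. (g x \<bullet> i) * \<phi> x))"

definition H1_space :: "'a::euclidean_space set \<Rightarrow> ('a \<Rightarrow> real) set" where
  "H1_space \<Omega> = {u \<in> L2_space \<Omega>. \<exists>g\<in>L2_space \<Omega>. weak_gradient \<Omega> u g}"

definition W_seminorm ::
    "'a::euclidean_space set \<Rightarrow> real \<Rightarrow> ('a \<Rightarrow> real) \<Rightarrow> ('a \<Rightarrow> real) \<Rightarrow> ennreal" where
  "W_seminorm \<Omega> R \<eta> u =
     ennsqrt (\<integral>\<^sup>+x\<in>\<Omega>. (\<integral>\<^sup>+y\<in>\<Omega> \<inter> {y. norm (y - x) \<le> R * \<eta> x}.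
       ennreal (\<bar>u x - u y\<bar>\<^sup>2 / \<eta> x ^ (DIM('a) + 2)) \<partial>lebesgue) \<partial>lebesgue)"

end

theory Submission
  imports Defs
begin

text \<open>
  For fixed \<open>h\<close>, testing the weak gradient against translated box bumps and letting the bumps increase
  to indicators of boxes gives \<open>u (x + h) - u x = \<integral>\<^sub>0\<^sup>1 g (x + t h) \<bullet> h dt\<close> for almost every \<open>x\<close> whose
  distance to the boundary exceeds \<open>|h|\<close>; no mollification of \<open>u\<close> is needed. By Fubini this holds for
  almost all pairs \<open>(x, h)\<close>, in particular where \<open>|h| \<le> R \<eta> x\<close>, since the bound on \<open>\<delta>\<close> forces \<open>\<eta>\<close>
  below the distance to the boundary. Now apply Cauchy-Schwarz in \<open>t\<close>, exchange the integrals and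
  translate by \<open>t h\<close>, a substitution with Jacobian 1: as \<open>|\<nabla>\<eta>| \<le> 1/3\<close>, the values of \<open>\<eta>\<close> at \<open>x\<close> and \<open>x + t h\<close> are
  comparable, and the remaining integral over \<open>h\<close> is the volume of a ball of radius \<open>3/2 \<eta> y\<close>
  times \<open>(4/3 / \<eta> y)\<^sup>d\<close>.
\<close>

section \<open>A smooth bump supported in a box\<close>

text \<open>\<open>flat 0\<close> is the classical smooth function that vanishes to infinite order
  at 0; the other \<open>flat k\<close> are the terms that its derivatives produce.\<close>

definition flat :: "nat \<Rightarrow> real \<Rightarrow> real" where
  "flat k t = (if t \<le> 0 then 0 else exp (- (1 / t)) / t ^ k)"

lemma flat_nonneg: "0 \<le> flat k t"
  by (simp add: flat_def)

text \<open>One term of the exponential series bounds \<open>(1/t) ^ k / fact k\<close> by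
  \<open>exp (1/t)\<close>. Uniformity in \<open>t\<close> matters: it controls the difference
  quotient at 0 and makes the bumps and their derivatives bounded.\<close>

lemma flat_le_fact: "flat k t \<le> fact k"
proof (cases "t \<le> 0")
  case False
  have "(1/t) ^ k / fact k \<le> (\<Sum>n. inverse (fact n) *\<^sub>R (1/t) ^ n)"
    using sum_le_suminf[OF summable_exp_generic, of "{k}" "1/t"] False
    by (simp add: divide_inverse mult.commute)
  also have "\<dots> = exp (1/t)"
    by (simp add: exp_def)
  finally show ?thesis
    using False by (simp add: flat_def exp_minus field_simps)
qed (simp add: flat_def)

text \<open>One formula serves on the whole line because every \<open>flat\<close> vanishes for
  nonpositive arguments. At 0 the difference quotient equals \<open>h * flat (k+2) h\<close>, which
  tends to 0 since \<open>flat (k+2)\<close> is bounded.\<close>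

lemma flat_has_derivative:
  "(flat k has_real_derivative flat (k+2) t - real k * flat (k+1) t) (at t)"
proof -
  consider "t < 0" | "t = 0" | "t > 0" by linarith
  then show ?thesis
  proof cases
    case 1
    have "((\<lambda>x::real. 0) has_real_derivative 0) (at t)" by simp
    then have "(flat k has_real_derivative 0) (at t)"
      by (rule has_field_derivative_transform_within_open[where S="{..<0}"])
         (use 1 in \<open>auto simp: flat_def\<close>)
    then show ?thesis using 1 by (simp add: flat_def)
  next
    case 2
    have eq: "flat k h / h = h * flat (k+2) h" for h
      by (simp add: flat_def power_add power2_eq_square field_simps)
    have "((\<lambda>h. h * flat (k+2) h) \<longlongrightarrow> 0) (at 0)"
    proof (rule Lim_null_comparison)
      show "\<forall>\<^sub>F h in at 0. norm (h * flat (k+2) h) \<le> \<bar>h\<bar> * fact (k+2)"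
        using flat_le_fact[of "k+2"] flat_nonneg[of "k+2"]
        by (intro always_eventually allI) (simp add: abs_mult mult_left_mono)
      show "((\<lambda>h. \<bar>h\<bar> * fact (k+2)) \<longlongrightarrow> 0) (at (0::real))"
        by (auto intro!: tendsto_eq_intros)
    qed
    then have "(flat k has_real_derivative 0) (at 0)"
      unfolding DERIV_def eq[symmetric] by (simp add: flat_def)
    then show ?thesis using 2 by (simp add: flat_def)
  next
    case 3
    have "((\<lambda>x. exp (- (1 / x)) / x ^ k) has_real_derivative
        flat (k+2) t - real k * flat (k+1) t) (at t)"
      using 3 by (auto intro!: derivative_eq_intros
          simp: flat_def field_simps power2_eq_square) (cases k; simp add: field_simps)
    then show ?thesis
      by (rule has_field_derivative_transform_within_open[where S="{0<..}"])
         (use 3 in \<open>auto simp: flat_def\<close>)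
  qed
qed

text \<open>The factors \<open>1 / t ^ k\<close> make this class of functions closed under differentiation.\<close>

inductive bump_algebra :: "('a::euclidean_space \<Rightarrow> real) \<Rightarrow> bool" where
  const: "bump_algebra (\<lambda>x. c)"
| flat: "bump_algebra (\<lambda>x. flat k (x \<bullet> v + c))"
| add: "bump_algebra f \<Longrightarrow> bump_algebra g \<Longrightarrow> bump_algebra (\<lambda>x. f x + g x)"
| mult: "bump_algebra f \<Longrightarrow> bump_algebra g \<Longrightarrow> bump_algebra (\<lambda>x. f x * g x)"

lemma bump_algebra_bounded:
  assumes "bump_algebra f"
  shows "\<exists>B. \<forall>x. \<bar>f x\<bar> \<le> B"
  using assms
proof induction
  case (flat k v c)
  then show ?case
    using flat_le_fact flat_nonneg by (auto intro!: exI[of _ "fact k"])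
next
  case (add f g)
  then obtain A B where "\<And>x. \<bar>f x\<bar> \<le> A" "\<And>x. \<bar>g x\<bar> \<le> B" by blast
  then show ?case
    by (intro exI[of _ "A + B"]) (metis abs_triangle_ineq add_mono order_trans)
next
  case (mult f g)
  then obtain A B where AB: "\<And>x. \<bar>f x\<bar> \<le> A" "\<And>x. \<bar>g x\<bar> \<le> B" by blast
  have "\<bar>f x * g x\<bar> \<le> A * B" for x
    unfolding abs_mult by (rule mult_mono) (use AB[of x] in auto)
  then show ?case by blast
qed auto

text \<open>The directional derivatives stay in the class, so smoothness of every order follows by
  iteration.\<close>

lemma bump_algebra_has_derivative:
  assumes "bump_algebra f"
  shows "\<exists>D. (\<forall>x. (f has_derivative D x) (at x)) \<and> (\<forall>v. bump_algebra (\<lambda>x. D x v))"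
  using assms
proof induction
  case (const c)
  show ?case
    by (intro exI[of _ "\<lambda>x v. 0"] conjI allI has_derivative_const bump_algebra.const)
next
  case (flat k v c)
  \<comment> \<open>The factors \<open>- real k\<close> and \<open>w \<bullet> v\<close> appear as
    constants in \<open>x\<close>, so that \<open>bump_algebra.intros\<close> matches the term
    literally.\<close>
  let ?D = "\<lambda>x w. (flat (k+2) (x \<bullet> v + c) + (- real k) * flat (k+1) (x \<bullet> v + c)) * (w \<bullet> v)"
  have "((\<lambda>x. flat k (x \<bullet> v + c)) has_derivative ?D x) (at x)" for x
  proof -
    have "((\<lambda>x. x \<bullet> v + c) has_derivative (\<lambda>w. w \<bullet> v)) (at x)"
      by (auto intro!: derivative_eq_intros)
    from has_derivative_compose[OF this flat_has_derivative[of k "x \<bullet> v + c", unfolded has_field_derivative_def]]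
    show ?thesis by (simp add: algebra_simps)
  qed
  moreover have "bump_algebra (\<lambda>x. ?D x w)" for w
    by (intro bump_algebra.intros)
  ultimately show ?case by (intro exI[of _ ?D]) blast
next
  case (add f g)
  then obtain D E where D: "\<And>x. (f has_derivative D x) (at x)" "\<And>v. bump_algebra (\<lambda>x. D x v)"
    and E: "\<And>x. (g has_derivative E x) (at x)" "\<And>v. bump_algebra (\<lambda>x. E x v)"
    by metis
  show ?case
    by (intro exI[of _ "\<lambda>x v. D x v + E x v"] conjI allI has_derivative_add bump_algebra.add D E)
next
  case (mult f g)
  then obtain D E where D: "\<And>x. (f has_derivative D x) (at x)" "\<And>v. bump_algebra (\<lambda>x. D x v)"
    and E: "\<And>x. (g has_derivative E x) (at x)" "\<And>v. bump_algebra (\<lambda>x. E x v)"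
    by metis
  show ?case
    by (intro exI[of _ "\<lambda>x v. f x * E x v + D x v * g x"] conjI allI has_derivative_mult
        bump_algebra.add bump_algebra.mult D E mult.hyps)
qed

lemma bump_algebra_differentiable: "bump_algebra f \<Longrightarrow> f differentiable at x"
  using bump_algebra_has_derivative unfolding differentiable_def by blast

lemma bump_algebra_partial_deriv:
  assumes "bump_algebra f"
  shows "bump_algebra (partial_deriv i f)"
proof -
  obtain D where D: "\<And>x. (f has_derivative D x) (at x)" "\<And>v. bump_algebra (\<lambda>x. D x v)"
    using bump_algebra_has_derivative[OF assms] by blast
  then have "partial_deriv i f = (\<lambda>x. D x i)"
    by (simp add: partial_deriv_def fun_eq_iff frechet_derivative_at[OF D(1), symmetric])
  then show ?thesis using D by simp
qed

lemma bump_algebra_continuous: "bump_algebra f \<Longrightarrow> continuous_on S f"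
  by (simp add: bump_algebra_differentiable continuous_at_imp_continuous_on
      differentiable_imp_continuous_within)

lemma bump_algebra_Ck_on: "bump_algebra f \<Longrightarrow> Ck_on k S f"
  by (induction k arbitrary: f)
     (auto simp: bump_algebra_continuous bump_algebra_differentiable bump_algebra_partial_deriv)

lemma bump_algebra_prod: "(\<And>i. i \<in> I \<Longrightarrow> bump_algebra (f i)) \<Longrightarrow> bump_algebra (\<lambda>x. \<Prod>i\<in>I. f i x)"
  by (induction I rule: infinite_finite_induct) (auto intro: bump_algebra.const bump_algebra.mult)

text \<open>
  Scaling by \<open>n\<close> inside \<open>exp (- 1 / t)\<close> lets the bumps tend to the indicator of the box while each
  of them stays bounded by 1 and vanishes outside it.
\<close>

definition box_bump :: "nat \<Rightarrow> 'a::euclidean_space \<Rightarrow> 'a \<Rightarrow> 'a \<Rightarrow> real" where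
  "box_bump n a b x = (\<Prod>i\<in>Basis. flat 0 (real n * (x \<bullet> i - a \<bullet> i)) * flat 0 (real n * (b \<bullet> i - x \<bullet> i)))"

lemma bump_algebra_box_bump: "bump_algebra (box_bump n a b)"
proof -
  have "box_bump n a b = (\<lambda>x. \<Prod>i\<in>Basis. flat 0 (x \<bullet> (real n *\<^sub>R i) + (- real n * (a \<bullet> i)))
      * flat 0 (x \<bullet> ((- real n) *\<^sub>R i) + real n * (b \<bullet> i)))"
    by (simp add: box_bump_def fun_eq_iff algebra_simps)
  moreover have "bump_algebra \<dots>"
    by (intro bump_algebra_prod bump_algebra.mult bump_algebra.flat)
  ultimately show ?thesis by simp
qed

lemma box_bump_nonneg: "0 \<le> box_bump n a b x"
  unfolding box_bump_def by (intro prod_nonneg mult_nonneg_nonneg flat_nonneg ballI)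

lemma box_bump_le_1: "box_bump n a b x \<le> 1"
  unfolding box_bump_def
  by (intro prod_le_1 conjI mult_le_one mult_nonneg_nonneg flat_nonneg)
     (use flat_le_fact[of 0] in auto)

lemma box_bump_translate: "box_bump n (a + c) (b + c) x = box_bump n a b (x - c)"
  by (simp add: box_bump_def algebra_simps)

lemma box_bump_eq_0: "x \<notin> box a b \<Longrightarrow> box_bump n a b x = 0"
  by (auto simp: box_bump_def mem_box flat_def not_less mult_le_0_iff)

text \<open>Inside the box each factor is \<open>exp (- 1 / (n * c))\<close> with a fixed
  \<open>c > 0\<close> and tends to \<open>exp 0\<close>; outside, every bump is already 0.\<close>

lemma box_bump_tendsto: "(\<lambda>n. box_bump n a b x) \<longlonglongrightarrow> indicator (box a b) x"
proof (cases "x \<in> box a b")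
  case True
  have 1: "(\<lambda>n. flat 0 (real n * c)) \<longlonglongrightarrow> 1" if "0 < c" for c
  proof -
    have "(\<lambda>n. exp (- (1 / c * (1 / real n)))) \<longlonglongrightarrow> exp (- (1 / c * 0))"
      by (intro tendsto_intros lim_1_over_n)
    \<comment> \<open>The equality fails at \<open>n = 0\<close>: there
      \<open>1 / real 0 = 0\<close> makes the left side 1, whereas
      \<open>flat 0 0 = 0\<close>.\<close>
    moreover have "\<forall>\<^sub>F n in sequentially. exp (- (1 / c * (1 / real n))) = flat 0 (real n * c)"
      using eventually_gt_at_top[of 0]
      by eventually_elim (use that in \<open>auto simp: flat_def mult_le_0_iff field_simps\<close>)
    ultimately show ?thesis
      by (simp add: filterlim_cong[OF refl refl, of _ _ sequentially] tendsto_cong)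
  qed
  have "(\<lambda>n. box_bump n a b x) \<longlonglongrightarrow> (\<Prod>i\<in>(Basis::'a set). 1 * 1)"
    unfolding box_bump_def by (intro tendsto_intros 1) (use True in \<open>auto simp: box_def\<close>)
  then show ?thesis using True by simp
qed (simp add: box_bump_eq_0)

lemma box_bump_test_function:
  assumes "cbox a b \<subseteq> \<Omega>"
  shows "box_bump n a b \<in> test_functions \<Omega>"
proof -
  have "{x. box_bump n a b x \<noteq> 0} \<subseteq> cbox a b"
    using box_bump_eq_0 box_subset_cbox by fastforce
  then have "closure {x. box_bump n a b x \<noteq> 0} \<subseteq> cbox a b"
    by (simp add: closure_minimal closed_cbox)
  moreover from this have "compact (closure {x. box_bump n a b x \<noteq> 0})"
    by (meson bounded_cbox bounded_subset closed_closure compact_eq_bounded_closed)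
  ultimately show ?thesis
    using assms by (auto simp: test_functions_def bump_algebra_Ck_on bump_algebra_box_bump)
qed

section \<open>The fundamental theorem of calculus for weak gradients\<close>

lemma nn_integral_lborel_translate:
  fixes f :: "'a::euclidean_space \<Rightarrow> ennreal"
  assumes [measurable]: "f \<in> borel_measurable borel"
  shows "(\<integral>\<^sup>+x. f (x + c) \<partial>lborel) = (\<integral>\<^sup>+x. f x \<partial>lborel)"
  by (subst (2) lborel_distr_plus[of c, symmetric]) (simp add: nn_integral_distr add.commute)

lemma lborel_integrable_translate:
  fixes f :: "'a::euclidean_space \<Rightarrow> 'b::{banach, second_countable_topology}"
  assumes "integrable lborel f"
  shows "integrable lborel (\<lambda>x. f (x + c))"
proof -
  have "integrable (distr lborel borel ((+) c)) f"
    using assms by (simp add: lborel_distr_plus)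
  from integrable_distr[OF _ this] show ?thesis
    by (simp add: add.commute)
qed

lemma lborel_integral_translate:
  fixes f :: "'a::euclidean_space \<Rightarrow> 'b::{banach, second_countable_topology}"
  assumes "f \<in> borel_measurable borel"
  shows "(LINT x|lborel. f (x + c)) = (LINT x|lborel. f x)"
proof -
  have "(LINT x|lborel. f x) = (LINT x|distr lborel borel ((+) c). f x)"
    by (simp add: lborel_distr_plus)
  also have "\<dots> = (LINT x|lborel. f (x + c))"
    using assms by (subst integral_distr) (auto simp: add.commute)
  finally show ?thesis ..
qed

text \<open>The positive and the negative part of \<open>f\<close> are densities of two finite
  measures that agree on boxes, an intersection-stable generator of the Borel sets. Hence the
  densities agree almost everywhere. As \<open>ennreal\<close> sends negative numbers to 0,
  \<open>ennreal (f x) = ennreal (- f x)\<close> forces \<open>f x = 0\<close>.\<close>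

lemma AE_eq_0_if_box_integrals_eq_0:
  fixes f :: "'a::euclidean_space \<Rightarrow> real"
  assumes f: "integrable lborel f"
    and zero: "\<And>c d. (LINT x|lborel. indicator (box c d) x * f x) = 0"
  shows "AE x in lborel. f x = 0"
proof -
  have [measurable]: "f \<in> borel_measurable borel" using f by auto
  have fin: "(\<integral>\<^sup>+x. ennreal (f x) \<partial>lborel) < \<infinity>" "(\<integral>\<^sup>+x. ennreal (- f x) \<partial>lborel) < \<infinity>"
    using f by (auto simp: real_integrable_def top.not_eq_extremum)
  have "density lborel (\<lambda>x. ennreal (f x)) = density lborel (\<lambda>x. ennreal (- f x))" (is "?M = ?N")
  proof (rule measure_eqI_generator_eq)
    let ?E = "range (\<lambda>(a, b). box a b::'a set)"
    show "Int_stable ?E"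
      by (auto simp: Int_stable_def box_Int_box)
    show "?E \<subseteq> Pow UNIV" "sets ?M = sigma_sets UNIV ?E" "sets ?N = sigma_sets UNIV ?E"
      by (simp_all add: borel_eq_box)
    let ?A = "\<lambda>n::nat. box (- (real n *\<^sub>R One)) (real n *\<^sub>R One) :: 'a set"
    show "range ?A \<subseteq> ?E" "(\<Union>i. ?A i) = UNIV"
      unfolding UN_box_eq_UNIV by auto
    have le: "emeasure (density lborel (\<lambda>x. ennreal (s * f x))) X < \<infinity>"
      if "X \<in> sets borel" "s = 1 \<or> s = -1" for X s
    proof -
      have "emeasure (density lborel (\<lambda>x. ennreal (s * f x))) X
          = (\<integral>\<^sup>+x. ennreal (s * f x) * indicator X x \<partial>lborel)"
        using that by (simp add: emeasure_density)
      also have "\<dots> \<le> (\<integral>\<^sup>+x. ennreal (s * f x) \<partial>lborel)"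
        by (intro nn_integral_mono) (auto split: split_indicator)
      also have "\<dots> < \<infinity>" using fin that by auto
      finally show ?thesis .
    qed
    show "emeasure ?M (?A i) \<noteq> \<infinity>" for i
      using le[of "?A i" 1] by simp
    show "emeasure ?M X = emeasure ?N X" if "X \<in> ?E" for X
    proof -
      from \<open>X \<in> ?E\<close> obtain c d where X: "X = box c d" by auto
      have int: "integrable lborel (\<lambda>x. indicator X x * f x)"
        using integrable_real_mult_indicator[of X lborel f] f by (simp add: X mult.commute)
      have 1: "(\<integral>\<^sup>+x. ennreal (indicator X x * f x) \<partial>lborel) = emeasure ?M X"
        by (auto simp: X emeasure_density intro!: nn_integral_cong split: split_indicator)
      have 2: "(\<integral>\<^sup>+x. ennreal (- (indicator X x * f x)) \<partial>lborel) = emeasure ?N X"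
        by (auto simp: X emeasure_density intro!: nn_integral_cong split: split_indicator)
      \<comment> \<open>A real integral is the difference of the integrals of the two parts, so a
        vanishing integral equates the two measures of \<open>X\<close>.\<close>
      have "enn2real (emeasure ?M X) = enn2real (emeasure ?N X)"
        using real_lebesgue_integral_def[OF int] zero[of c d, folded X] unfolding 1 2 by simp
      moreover have "emeasure ?M X < \<infinity>" "emeasure ?N X < \<infinity>"
        using le[of X 1] le[of X "-1"] X by auto
      ultimately show ?thesis
        by (metis ennreal_enn2real infinity_ennreal_def)
    qed
  qed
  then have "AE x in lborel. ennreal (f x) = ennreal (- f x)"
    using fin by (subst (asm) finite_density_unique) auto
  then show ?thesis
    by eventually_elim (metis ennreal_inj ennreal_neg le_cases neg_equal_0_iff_equal
        neg_le_0_iff_le neg_0_le_iff_le equal_neg_zero)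
qed

text \<open>The difference cut off to \<open>box a b\<close> is integrated over arbitrary boxes;
  since boxes intersect in boxes, only boxes inside \<open>box a b\<close> have to be
  tested.\<close>

lemma AE_eq_on_box_if_box_integrals_eq:
  fixes f g :: "'a::euclidean_space \<Rightarrow> real"
  assumes f: "integrable lborel f" and g: "integrable lborel g"
    and eq: "\<And>c d. cbox c d \<subseteq> cbox a b \<Longrightarrow>
      (LINT x|lborel. indicator (box c d) x * f x) = (LINT x|lborel. indicator (box c d) x * g x)"
  shows "AE x in lborel. x \<in> box a b \<longrightarrow> f x = g x"
proof -
  have int: "integrable lborel (\<lambda>x. indicator S x * F x)" if "integrable lborel F" "S \<in> sets borel"
    for F :: "'a \<Rightarrow> real" and S
    using integrable_real_mult_indicator[of S lborel F] that by (simp add: mult.commute)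
  let ?h = "\<lambda>x. indicator (box a b) x * (f x - g x)"
  have "AE x in lborel. ?h x = 0"
  proof (rule AE_eq_0_if_box_integrals_eq_0)
    show "integrable lborel ?h"
      by (intro int Bochner_Integration.integrable_diff f g) simp
    fix c d :: 'a
    obtain p q where pq: "box c d \<inter> box a b = box p q"
      using box_Int_box by blast
    show "(LINT x|lborel. indicator (box c d) x * ?h x) = 0"
    \<comment> \<open>If \<open>box p q\<close> is empty, nothing confines \<open>cbox p q\<close>
      to \<open>cbox a b\<close>, so the inclusion needed for \<open>eq\<close> is available only in
      the other case.\<close>
    proof (cases "box p q = {}")
      case True
      then have "indicator (box c d) x * ?h x = 0" for x
        using True pq by (auto split: split_indicator)
      then show ?thesis by (simp only: Bochner_Integration.integral_zero)
    next
      case False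
      have "box p q \<subseteq> box a b" using pq by auto
      then have "cbox p q \<subseteq> cbox a b"
        by (metis False closure_mono closure_box box_eq_empty(1) subset_box(3) subset_empty closure_minimal
            box_subset_cbox closed_cbox order_trans)
      have "(LINT x|lborel. indicator (box c d) x * ?h x)
          = (LINT x|lborel. indicator (box p q) x * f x - indicator (box p q) x * g x)"
        unfolding pq[symmetric] by (intro Bochner_Integration.integral_cong) (auto split: split_indicator)
      also have "\<dots> = 0"
        using eq[OF \<open>cbox p q \<subseteq> cbox a b\<close>] by (simp add: int f g)
      finally show ?thesis .
    qed
  qed
  then show ?thesis by eventually_elim (auto split: split_indicator)
qed

text \<open>Justifies the exchanges of integrals below. Translation preserves the L1 norm in
  \<open>x\<close>, \<open>t\<close> runs over an interval of length 1, and the bounded factor is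
  dominated by \<open>B\<close>. Two directions \<open>k\<close> and \<open>l\<close> are kept
  because either factor may be the one that is shifted.\<close>

lemma integrable_translation_pair:
  fixes F \<psi> :: "'a::euclidean_space \<Rightarrow> real"
  assumes F: "integrable lborel F" and [measurable]: "\<psi> \<in> borel_measurable borel"
    and B: "\<And>x. \<bar>\<psi> x\<bar> \<le> B"
  shows "integrable (lborel \<Otimes>\<^sub>M lborel)
    (\<lambda>(t::real, x). indicator {0..1} t * (F (x + t *\<^sub>R k) * \<psi> (x + t *\<^sub>R l)))"
proof -
  have [measurable]: "F \<in> borel_measurable borel" using F by auto
  let ?H = "\<lambda>(t::real, x). indicator {0..1} t * F (x + t *\<^sub>R k)"
  have "integrable (lborel \<Otimes>\<^sub>M lborel) ?H"
  proof (rule lborel_pair.Fubini_integrable)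
    show "?H \<in> borel_measurable (lborel \<Otimes>\<^sub>M lborel)" by measurable
    have "(LINT y|lborel. norm (?H (t, y))) = indicator {0..1} t * (LINT y|lborel. \<bar>F y\<bar>)" for t
      using lborel_integral_translate[of "\<lambda>y. \<bar>F y\<bar>" "t *\<^sub>R k"] by (simp add: abs_mult)
    then show "integrable lborel (\<lambda>t. LINT y|lborel. norm (?H (t, y)))"
      by simp
    show "AE t in lborel. integrable lborel (\<lambda>y. ?H (t, y))"
      using lborel_integrable_translate[OF F] by simp
  qed
  then have "integrable (lborel \<Otimes>\<^sub>M lborel) (\<lambda>p. B * ?H p)" by simp
  then show ?thesis
  proof (rule Bochner_Integration.integrable_bound)
    have "norm (indicator {0..1} t * (F (x + t *\<^sub>R k) * \<psi> (x + t *\<^sub>R l)))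
       \<le> norm (B * (indicator {0..1} t * F (x + t *\<^sub>R k)))" for t :: real and x
    proof -
      have "\<bar>\<psi> (x + t *\<^sub>R l)\<bar> \<le> \<bar>B\<bar>" using B[of "x + t *\<^sub>R l"] by linarith
      then show ?thesis
        by (auto simp: abs_mult mult.commute[of "\<bar>B\<bar>"] intro!: mult_left_mono split: split_indicator)
    qed
    then show "AE p in lborel \<Otimes>\<^sub>M lborel. norm (case p of (t, x) \<Rightarrow>
        indicator {0..1} t * (F (x + t *\<^sub>R k) * \<psi> (x + t *\<^sub>R l))) \<le> norm (B * ?H p)"
      by auto
  qed measurable
qed

section \<open>The difference identity tested against bumps\<close>

lemma bump_algebra_frechet_derivative:
  assumes "bump_algebra \<phi>"
  shows "(\<phi> has_derivative (\<lambda>v. \<Sum>i\<in>Basis. (v \<bullet> i) * partial_deriv i \<phi> x)) (at x)"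
proof -
  have D: "(\<phi> has_derivative frechet_derivative \<phi> (at x)) (at x)"
    using bump_algebra_differentiable[OF assms] by (simp add: frechet_derivative_works[symmetric])
  then interpret bounded_linear "frechet_derivative \<phi> (at x)"
    by (rule has_derivative_bounded_linear)
  have "frechet_derivative \<phi> (at x) v = (\<Sum>i\<in>Basis. (v \<bullet> i) * partial_deriv i \<phi> x)" for v
    by (subst euclidean_representation[of v, symmetric])
       (simp only: sum scale partial_deriv_def real_scaleR_def)
  then show ?thesis using D by presburger
qed

lemma partial_deriv_translate:
  assumes "bump_algebra \<phi>"
  shows "partial_deriv i (\<lambda>x. \<phi> (x - c)) x = partial_deriv i \<phi> (x - c)"
proof -
  have *: "((\<lambda>x. \<phi> (x - c)) has_derivative (\<lambda>v. \<Sum>j\<in>Basis. (v \<bullet> j) * partial_deriv j \<phi> (x - c))) (at x)"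
    by (rule has_derivative_compose[OF _ bump_algebra_frechet_derivative[OF assms]])
       (auto intro!: derivative_eq_intros)
  have "partial_deriv i (\<lambda>x. \<phi> (x - c)) x = (\<Sum>j\<in>Basis. (i \<bullet> j) * partial_deriv j \<phi> (x - c))"
    unfolding partial_deriv_def[of i "\<lambda>x. \<phi> (x - c)"] frechet_derivative_at[OF *, symmetric] ..
  also have "\<dots> = partial_deriv i \<phi> (x - c)"
    unfolding partial_deriv_def[of i \<phi>]
      frechet_derivative_at[OF bump_algebra_frechet_derivative[OF assms], symmetric] ..
  finally show ?thesis .
qed

lemma bump_algebra_FTC:
  assumes \<phi>: "bump_algebra \<phi>"
  shows "\<phi> (y - h) - \<phi> y =
    (LINT t|lborel. indicator {0..1} t * (- (\<Sum>i\<in>Basis. (h \<bullet> i) * partial_deriv i \<phi> (y - t *\<^sub>R h))))"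
proof -
  let ?d = "\<lambda>t. - (\<Sum>i\<in>Basis. (h \<bullet> i) * partial_deriv i \<phi> (y - t *\<^sub>R h))"
  have "((\<lambda>t. \<phi> (y - t *\<^sub>R h)) has_real_derivative ?d t) (at t)" for t
  proof -
    have "((\<lambda>t. y - t *\<^sub>R h) has_derivative (\<lambda>s. - (s *\<^sub>R h))) (at t)"
      by (auto intro!: derivative_eq_intros)
    from has_derivative_compose[OF this bump_algebra_frechet_derivative[OF \<phi>]]
    have "((\<lambda>t. \<phi> (y - t *\<^sub>R h)) has_derivative
       (\<lambda>s. \<Sum>i\<in>Basis. (- (s *\<^sub>R h) \<bullet> i) * partial_deriv i \<phi> (y - t *\<^sub>R h))) (at t)" .
    moreover have "(\<lambda>s. \<Sum>i\<in>Basis. (- (s *\<^sub>R h) \<bullet> i) * partial_deriv i \<phi> (y - t *\<^sub>R h)) = (*) (?d t)"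
      by (simp add: fun_eq_iff sum_negf sum_distrib_left algebra_simps)
    ultimately show ?thesis
      unfolding has_field_derivative_def by simp
  qed
  moreover have "isCont ?d t" for t
  proof -
    have "continuous_on UNIV (\<lambda>t. partial_deriv i \<phi> (y - t *\<^sub>R h))" for i
      by (rule continuous_on_compose2[OF bump_algebra_continuous[OF bump_algebra_partial_deriv[OF \<phi>], of UNIV]])
         (auto intro!: continuous_intros)
    then show ?thesis
      by (intro continuous_intros) (auto simp: continuous_on_eq_continuous_at)
  qed
  ultimately have "(LINT t|lborel. ?d t * indicator {0..1} t) = \<phi> (y - 1 *\<^sub>R h) - \<phi> (y - 0 *\<^sub>R h)"
    by (intro integral_FTC_Icc_real) auto
  then show ?thesis by (simp add: mult.commute)
qed

text \<open>Translation moves the difference from \<open>u\<close> to \<open>\<phi>\<close>, where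
  the classical fundamental theorem applies. After an exchange of integrals, the weak gradient is
  tested against \<open>\<phi>\<close> translated by \<open>t *\<^sub>R h\<close>, for each
  \<open>t\<close> separately; translating back leaves \<open>g\<close> evaluated along the
  segment.\<close>

lemma weak_FTC_bump:
  fixes u :: "'a::euclidean_space \<Rightarrow> real" and g :: "'a \<Rightarrow> 'a"
  assumes u: "integrable lborel u" and g: "integrable lborel g" and \<phi>: "bump_algebra \<phi>"
    and weak: "\<And>t i. t \<in> {0..1} \<Longrightarrow> i \<in> Basis \<Longrightarrow>
      (LINT x|lborel. u x * partial_deriv i \<phi> (x - t *\<^sub>R h)) = - (LINT x|lborel. (g x \<bullet> i) * \<phi> (x - t *\<^sub>R h))"
  shows "(LINT x|lborel. (u (x + h) - u x) * \<phi> x) =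
    (LINT x|lborel. (LINT t|lborel. indicator {0..1} t * (g (x + t *\<^sub>R h) \<bullet> h)) * \<phi> x)"
proof -
  let ?p = "\<lambda>i. partial_deriv i \<phi>"
  have gi: "integrable lborel (\<lambda>x. g x \<bullet> v)" for v using g by simp
  have meas: "\<psi> \<in> borel_measurable borel" if "bump_algebra \<psi>" for \<psi> :: "'a \<Rightarrow> real"
    using that by (intro borel_measurable_continuous_onI bump_algebra_continuous)
  have [measurable]: "u \<in> borel_measurable borel" "g \<in> borel_measurable borel" "\<phi> \<in> borel_measurable borel"
    "?p i \<in> borel_measurable borel" for i
    using u g \<phi> by (auto intro: meas bump_algebra_partial_deriv)
  have bdd: "integrable lborel (\<lambda>x. F x * \<psi> (x - c))" if F: "integrable lborel F" and \<psi>: "bump_algebra \<psi>"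
    for F \<psi> :: "'a \<Rightarrow> real" and c
  proof -
    have [measurable]: "F \<in> borel_measurable borel" "\<psi> \<in> borel_measurable borel"
      using F \<psi> meas by auto
    obtain B where "\<And>x. \<bar>\<psi> x\<bar> \<le> B" using bump_algebra_bounded[OF \<psi>] by blast
    then have B: "\<bar>\<psi> (x - c)\<bar> \<le> \<bar>B\<bar>" for x
      by (meson abs_ge_self order_trans)
    have le: "norm (F x * \<psi> (x - c)) \<le> norm (B * F x)" for x
      using mult_left_mono[OF B, of "\<bar>F x\<bar>"] by (simp add: abs_mult mult.commute)
    have "integrable lborel (\<lambda>x. B * F x)" using F by simp
    then show ?thesis
      by (rule Bochner_Integration.integrable_bound) (use le in simp_all)
  qed
  have pair: "integrable (lborel \<Otimes>\<^sub>M lborel)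
     (\<lambda>(t::real, x). indicator {0..1} t * (F (x + t *\<^sub>R k) * \<psi> (x + t *\<^sub>R l)))"
    if F: "integrable lborel F" and \<psi>: "bump_algebra \<psi>" for F \<psi> :: "'a \<Rightarrow> real" and k l
  proof -
    obtain B where "\<And>x. \<bar>\<psi> x\<bar> \<le> B" using bump_algebra_bounded[OF \<psi>] by blast
    then show ?thesis
      by (intro integrable_translation_pair[OF F meas[OF \<psi>], of B])
  qed
  have \<phi>0: "integrable lborel (\<lambda>x. F x * \<phi> x)" if "integrable lborel F" for F
    using bdd[OF that \<phi>, of 0] by simp
  \<comment> \<open>The argument of \<open>\<phi>\<close> is written as \<open>(x + h) - h\<close>
    to exhibit the integrand as a translate by \<open>h\<close>.\<close>
  have "(LINT x|lborel. (u (x + h) - u x) * \<phi> x)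
      = (LINT x|lborel. u (x + h) * \<phi> ((x + h) - h)) - (LINT x|lborel. u x * \<phi> x)"
    using \<phi>0[OF u] \<phi>0[OF lborel_integrable_translate[OF u, of h]]
    by (simp add: left_diff_distrib)
  also have "(LINT x|lborel. u (x + h) * \<phi> ((x + h) - h)) = (LINT y|lborel. u y * \<phi> (y - h))"
    by (rule lborel_integral_translate) measurable
  also have "\<dots> - (LINT x|lborel. u x * \<phi> x) = (LINT y|lborel. u y * (\<phi> (y - h) - \<phi> y))"
    using \<phi>0[OF u] bdd[OF u \<phi>, of h] by (simp add: right_diff_distrib)
  also have "\<dots> = (LINT y|lborel. LINT t|lborel.
      (\<Sum>i\<in>Basis. - (h \<bullet> i) * (indicator {0..1} t * (u y * ?p i (y - t *\<^sub>R h)))))"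
    unfolding bump_algebra_FTC[OF \<phi>]
    by (subst integral_mult_right_zero[symmetric])
       (simp add: sum_distrib_left sum_negf algebra_simps)
  also have "\<dots> = (LINT t|lborel. LINT y|lborel.
      (\<Sum>i\<in>Basis. - (h \<bullet> i) * (indicator {0..1} t * (u y * ?p i (y - t *\<^sub>R h)))))"
  proof (rule lborel_pair.Fubini_integral)
    have "integrable (lborel \<Otimes>\<^sub>M lborel) (\<lambda>p. \<Sum>i\<in>Basis. - (h \<bullet> i) *
        (case p of (t, y) \<Rightarrow> indicator {0..1} t * (u (y + t *\<^sub>R 0) * ?p i (y + t *\<^sub>R (- h)))))"
      by (intro Bochner_Integration.integrable_sum integrable_mult_right pair u
          bump_algebra_partial_deriv \<phi>)
    then show "integrable (lborel \<Otimes>\<^sub>M lborel) (\<lambda>(t, y).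
       \<Sum>i\<in>Basis. - (h \<bullet> i) * (indicator {0..1} t * (u y * ?p i (y - t *\<^sub>R h))))"
      by (simp add: case_prod_unfold)
  qed
  also have "\<dots> = (LINT t|lborel. LINT x|lborel. indicator {0..1} t * ((g (x + t *\<^sub>R h) \<bullet> h) * \<phi> x))"
  proof (rule Bochner_Integration.integral_cong[OF refl])
    fix t :: real
    have *: "(LINT y|lborel. (g y \<bullet> i) * \<phi> (y - t *\<^sub>R h)) = (LINT x|lborel. (g (x + t *\<^sub>R h) \<bullet> i) * \<phi> x)" for i
      using lborel_integral_translate[of "\<lambda>y. (g y \<bullet> i) * \<phi> (y - t *\<^sub>R h)" "t *\<^sub>R h"] by simp
    have git: "integrable lborel (\<lambda>x. (g (x + t *\<^sub>R h) \<bullet> i) * \<phi> x)" for i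
      using \<phi>0[OF lborel_integrable_translate[OF gi[of i], of "t *\<^sub>R h"]] .
    have "(LINT y|lborel. (\<Sum>i\<in>Basis. - (h \<bullet> i) * (indicator {0..1} t * (u y * ?p i (y - t *\<^sub>R h)))))
        = (\<Sum>i\<in>Basis. - (h \<bullet> i) * (indicator {0..1} t * (LINT y|lborel. u y * ?p i (y - t *\<^sub>R h))))"
      by (subst Bochner_Integration.integral_sum)
         (auto intro!: bdd u bump_algebra_partial_deriv \<phi>)
    \<comment> \<open>The minus sign of the backward difference cancels the one from the weak
      gradient. Outside the unit interval, where \<open>weak\<close> says nothing, the indicator
      makes both sides 0.\<close>
    also have "\<dots> = (\<Sum>i\<in>Basis. (h \<bullet> i) * (indicator {0..1} t * (LINT x|lborel. (g (x + t *\<^sub>R h) \<bullet> i) * \<phi> x)))"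
      by (intro sum.cong refl) (simp add: weak * split: split_indicator)
    also have "\<dots> = (LINT x|lborel. (\<Sum>i\<in>Basis. (h \<bullet> i) * (indicator {0..1} t * ((g (x + t *\<^sub>R h) \<bullet> i) * \<phi> x))))"
      by (subst Bochner_Integration.integral_sum) (auto intro!: git)
    also have "\<dots> = (LINT x|lborel. indicator {0..1} t * ((g (x + t *\<^sub>R h) \<bullet> h) * \<phi> x))"
      by (intro Bochner_Integration.integral_cong refl)
         (subst (2) euclidean_inner, simp add: sum_distrib_left sum_distrib_right algebra_simps)
    finally show "(LINT y|lborel. (\<Sum>i\<in>Basis. - (h \<bullet> i) * (indicator {0..1} t * (u y * ?p i (y - t *\<^sub>R h)))))
      = (LINT x|lborel. indicator {0..1} t * ((g (x + t *\<^sub>R h) \<bullet> h) * \<phi> x))" .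
  qed
  also have "\<dots> = (LINT x|lborel. LINT t|lborel. indicator {0..1} t * ((g (x + t *\<^sub>R h) \<bullet> h) * \<phi> x))"
    by (rule lborel_pair.Fubini_integral[symmetric]) (use pair[OF gi \<phi>, of h h 0] in simp)
  also have "\<dots> = (LINT x|lborel. (LINT t|lborel. indicator {0..1} t * (g (x + t *\<^sub>R h) \<bullet> h)) * \<phi> x)"
    by (simp flip: mult.assoc)
  finally show ?thesis .
qed

text \<open>For a subbox of \<open>cbox a b\<close>, all translates along the segment stay in
  \<open>K\<close>, so the identity holds for its bumps. Dominated convergence replaces the bumps by
  the indicator of the subbox, and the integrals over subboxes determine both functions.\<close>

lemma weak_FTC_AE_box:
  fixes u :: "'a::euclidean_space \<Rightarrow> real" and g :: "'a \<Rightarrow> 'a"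
  assumes u: "integrable lborel u" and g: "integrable lborel g"
    and weak: "\<And>c d n i. cbox c d \<subseteq> K \<Longrightarrow> i \<in> Basis \<Longrightarrow>
      (LINT x|lborel. u x * partial_deriv i (box_bump n c d) x)
        = - (LINT x|lborel. (g x \<bullet> i) * box_bump n c d x)"
    and K: "\<And>t x. t \<in> {0..1} \<Longrightarrow> x \<in> cbox a b \<Longrightarrow> x + t *\<^sub>R h \<in> K"
  shows "AE x in lborel. x \<in> box a b \<longrightarrow>
    u (x + h) - u x = (LINT t|lborel. indicator {0..1} t * (g (x + t *\<^sub>R h) \<bullet> h))"
proof (rule AE_eq_on_box_if_box_integrals_eq)
  let ?D = "\<lambda>x. u (x + h) - u x"
  let ?G = "\<lambda>x. LINT t|lborel. indicator {0..1} t * (g (x + t *\<^sub>R h) \<bullet> h)"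
  show D: "integrable lborel ?D"
    by (intro Bochner_Integration.integrable_diff lborel_integrable_translate u)
  \<comment> \<open>The constant weight 1 gives integrability of the gradient averaged over
    segments.\<close>
  have "integrable (lborel \<Otimes>\<^sub>M lborel)
     (\<lambda>(t::real, x). indicator {0..1} t * ((g (x + t *\<^sub>R h) \<bullet> h) * 1))"
    using g by (intro integrable_translation_pair[where \<psi>="\<lambda>_. 1" and B=1 and F="\<lambda>x. g x \<bullet> h"]) auto
  from lborel_pair.integrable_snd[OF this] show G: "integrable lborel ?G" by simp
  fix c d assume cd: "cbox c d \<subseteq> cbox a b"
  have lim: "(\<lambda>n. LINT x|lborel. F x * box_bump n c d x) \<longlonglongrightarrow> (LINT x|lborel. indicator (box c d) x * F x)"
    if F: "integrable lborel F" for F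
  proof (rule integral_dominated_convergence[where w="\<lambda>x. \<bar>F x\<bar>"])
    have [measurable]: "F \<in> borel_measurable borel" "box_bump n c d \<in> borel_measurable borel" for n
      using F by (auto intro: borel_measurable_continuous_onI bump_algebra_continuous bump_algebra_box_bump)
    show "(\<lambda>x. F x * box_bump n c d x) \<in> borel_measurable lborel"
      "(\<lambda>x. indicator (box c d) x * F x) \<in> borel_measurable lborel" for n
      by measurable
    show "AE x in lborel. (\<lambda>n. F x * box_bump n c d x) \<longlonglongrightarrow> indicator (box c d) x * F x"
      by (subst mult.commute) (intro always_eventually allI tendsto_mult_right box_bump_tendsto)
    show "AE x in lborel. norm (F x * box_bump n c d x) \<le> \<bar>F x\<bar>" for n
      by (simp add: abs_mult box_bump_nonneg mult_left_le box_bump_le_1)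
  qed (use F in simp)
  have eq: "(LINT x|lborel. ?D x * box_bump n c d x) = (LINT x|lborel. ?G x * box_bump n c d x)" for n
  proof (rule weak_FTC_bump[OF u g bump_algebra_box_bump])
    fix t :: real and i :: 'a assume t: "t \<in> {0..1}" and i: "i \<in> Basis"
    have "cbox (c + t *\<^sub>R h) (d + t *\<^sub>R h) \<subseteq> K"
    proof
      fix x assume "x \<in> cbox (c + t *\<^sub>R h) (d + t *\<^sub>R h)"
      then have "x - t *\<^sub>R h \<in> cbox c d" by (auto simp: mem_box algebra_simps)
      then show "x \<in> K" using K[OF t, of "x - t *\<^sub>R h"] cd by auto
    qed
    \<comment> \<open>A translated bump is again a bump, namely that of the translated box.\<close>
    from weak[OF this i, of n]
    show "(LINT x|lborel. u x * partial_deriv i (box_bump n c d) (x - t *\<^sub>R h))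
      = - (LINT x|lborel. (g x \<bullet> i) * box_bump n c d (x - t *\<^sub>R h))"
      by (simp add: box_bump_translate[abs_def] partial_deriv_translate[OF bump_algebra_box_bump])
  qed
  show "(LINT x|lborel. indicator (box c d) x * ?D x) = (LINT x|lborel. indicator (box c d) x * ?G x)"
    by (rule LIMSEQ_unique[OF lim[OF D, unfolded eq] lim[OF G]])
qed

section \<open>From boxes to almost all pairs in the domain\<close>

lemma partial_deriv_box_bump_eq_0:
  assumes "x \<notin> cbox a b"
  shows "partial_deriv i (box_bump n a b) x = 0"
proof -
  have "((\<lambda>x. 0 :: real) has_derivative (\<lambda>v. 0)) (at x)"
    by simp
  then have "(box_bump n a b has_derivative (\<lambda>v. 0)) (at x)"
  proof (rule has_derivative_transform_within_open)
    show "open (- cbox a b)" by (simp add: closed_cbox open_Compl)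
    show "0 = box_bump n a b y" if "y \<in> - cbox a b" for y
      using that box_bump_eq_0[of y a b n] box_subset_cbox[of a b] by auto
  qed (use assms in simp)
  then show ?thesis
    unfolding partial_deriv_def by (metis frechet_derivative_at)
qed

text \<open>By Lindelof's theorem countably many of the neighbourhoods cover \<open>U\<close>, so
  only countably many null sets are united.\<close>

lemma AE_on_open_if_locally:
  fixes U :: "'a::euclidean_space set"
  assumes "\<And>p. p \<in> U \<Longrightarrow> \<exists>V. open V \<and> p \<in> V \<and> (AE x in M. x \<in> V \<longrightarrow> P x)"
  shows "AE x in M. x \<in> U \<longrightarrow> P x"
proof -
  let ?F = "{V. open V \<and> (AE x in M. x \<in> V \<longrightarrow> P x)}"
  obtain F' where F': "F' \<subseteq> ?F" "countable F'" "\<Union>F' = \<Union>?F"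
    using Lindelof[of ?F] by blast
  have "AE x in M. \<forall>V\<in>F'. x \<in> V \<longrightarrow> P x"
    using F' by (intro AE_ball_countable') auto
  moreover have "U \<subseteq> \<Union>F'"
    using assms unfolding F' by blast
  ultimately show ?thesis
    by (auto elim!: eventually_mono)
qed

text \<open>A ball is connected: if it met both \<Omega> and its complement, it would contain a
  frontier point at distance at most \<open>r\<close>.\<close>

lemma cball_subset_if_infdist_frontier:
  fixes \<Omega> :: "'a::euclidean_space set"
  assumes "x \<in> \<Omega>" "r < infdist x (frontier \<Omega>)"
  shows "cball x r \<subseteq> \<Omega>"
proof (rule ccontr)
  assume *: "\<not> cball x r \<subseteq> \<Omega>"
  then obtain y where "y \<in> cball x r" "y \<notin> \<Omega>" by blast
  then have "x \<in> cball x r"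
    by (metis centre_in_cball dual_order.trans mem_cball zero_le_dist)
  then have "cball x r \<inter> frontier \<Omega> \<noteq> {}"
    using assms(1) \<open>y \<in> cball x r\<close> \<open>y \<notin> \<Omega>\<close>
    by (intro connected_Int_frontier convex_connected[OF convex_cball]) blast+
  then obtain z where "z \<in> frontier \<Omega>" "dist x z \<le> r" by auto
  then show False using assms(2) infdist_le[of z "frontier \<Omega>" x] by linarith
qed

text \<open>The data are only locally integrable, so they are cut off to a compact ball
  \<open>K\<close> slightly larger than \<open>cball p (norm h)\<close>. A small box around
  \<open>p\<close> then has all its segments in direction \<open>h\<close> inside \<open>K\<close>,
  and such boxes give the claim locally.\<close>

lemma weak_FTC_AE:
  fixes u :: "'a::euclidean_space \<Rightarrow> real" and g :: "'a \<Rightarrow> 'a"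
  assumes \<Omega>: "open \<Omega>"
    and u: "\<And>K. compact K \<Longrightarrow> K \<subseteq> \<Omega> \<Longrightarrow> set_integrable lborel K u"
    and g: "\<And>K. compact K \<Longrightarrow> K \<subseteq> \<Omega> \<Longrightarrow> set_integrable lborel K g"
    and weak: "\<And>c d n i. cbox c d \<subseteq> \<Omega> \<Longrightarrow> i \<in> Basis \<Longrightarrow>
      (LINT x|lborel. u x * partial_deriv i (box_bump n c d) x)
        = - (LINT x|lborel. (g x \<bullet> i) * box_bump n c d x)"
  shows "AE x in lborel. x \<in> {x. cball x (norm h) \<subseteq> \<Omega>} \<longrightarrow>
    u (x + h) - u x = (LINT t|lborel. indicator {0..1} t * (g (x + t *\<^sub>R h) \<bullet> h))"
proof (rule AE_on_open_if_locally)
  fix p assume "p \<in> {x. cball x (norm h) \<subseteq> \<Omega>}"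
  then obtain e where e: "e > 0" "(\<Union>x\<in>cball p (norm h). cball x e) \<subseteq> \<Omega>"
    using compact_subset_open_imp_cball_epsilon_subset[OF compact_cball \<Omega>, of p "norm h"] by blast
  have "cball p (norm h + e) \<subseteq> \<Omega>"
  proof
    fix y assume "y \<in> cball p (norm h + e)"
    then have y: "norm (y - p) \<le> norm h + e"
      by (simp add: dist_norm norm_minus_commute)
    \<comment> \<open>The point at fraction \<open>s\<close> of the segment from \<open>p\<close> to
      \<open>y\<close> is within \<open>norm h\<close> of \<open>p\<close> and within
      \<open>e\<close> of \<open>y\<close>.\<close>
    define s where "s = norm h / (norm h + e)"
    have s: "0 \<le> s" "s \<le> 1" "s * (norm h + e) = norm h"
      using add_nonneg_pos[OF norm_ge_zero[of h] \<open>e > 0\<close>] \<open>e > 0\<close>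
      by (simp_all add: s_def divide_le_eq_1_pos)
    let ?x = "p + s *\<^sub>R (y - p)"
    have "s * norm (y - p) \<le> s * (norm h + e)" "(1 - s) * norm (y - p) \<le> (1 - s) * (norm h + e)"
      using mult_left_mono[OF y s(1)] mult_left_mono[OF y, of "1 - s"] s(2) by simp_all
    moreover have "(1 - s) * (norm h + e) = e" using s(3) by (simp add: algebra_simps)
    moreover have "dist p ?x = s * norm (y - p)" using s by (simp add: dist_norm)
    moreover have "dist ?x y = (1 - s) * norm (y - p)"
    proof -
      have "y - ?x = (1 - s) *\<^sub>R (y - p)" by (simp add: algebra_simps)
      then show ?thesis using s by (metis dist_commute dist_norm norm_scaleR abs_of_nonneg diff_ge_0_iff_ge)
    qed
    ultimately have "?x \<in> cball p (norm h)" "y \<in> cball ?x e" using s(3) by auto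
    then show "y \<in> \<Omega>" using e by blast
  qed
  then obtain K where K: "K = cball p (norm h + e)" "K \<subseteq> \<Omega>" "compact K" by auto
  obtain a b where ab: "p \<in> box a b" "cbox a b \<subseteq> ball p e"
    using open_contains_cbox[OF open_ball] \<open>e > 0\<close> by (metis centre_in_ball)
  let ?u = "\<lambda>x. indicator K x *\<^sub>R u x" and ?g = "\<lambda>x. indicator K x *\<^sub>R g x"
  have shift: "x + t *\<^sub>R h \<in> K" if "t \<in> {0..1}" "x \<in> cbox a b" for t x
  proof -
    have "norm (t *\<^sub>R h) \<le> norm h"
      using that(1) by (simp add: mult_left_le_one_le)
    moreover have "dist p x < e" using that(2) ab by auto
    moreover have "dist p (x + t *\<^sub>R h) \<le> dist p x + norm (t *\<^sub>R h)"
      by (metis dist_triangle dist_norm add_diff_cancel_left' dist_commute)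
    ultimately show ?thesis by (simp add: K)
  qed
  have "AE x in lborel. x \<in> box a b \<longrightarrow>
    ?u (x + h) - ?u x = (LINT t|lborel. indicator {0..1} t * (?g (x + t *\<^sub>R h) \<bullet> h))"
  proof (rule weak_FTC_AE_box[where K=K])
    show "integrable lborel ?u" "integrable lborel ?g"
      using u[OF K(3,2)] g[OF K(3,2)] by (auto simp: set_integrable_def)
    fix c d n and i :: 'a assume cd: "cbox c d \<subseteq> K" and i: "i \<in> Basis"
    have "(LINT x|lborel. ?u x * partial_deriv i (box_bump n c d) x)
        = (LINT x|lborel. u x * partial_deriv i (box_bump n c d) x)"
      using cd partial_deriv_box_bump_eq_0[of _ c d i n]
      by (intro Bochner_Integration.integral_cong refl) (auto split: split_indicator)
    moreover have "(LINT x|lborel. (?g x \<bullet> i) * box_bump n c d x)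
        = (LINT x|lborel. (g x \<bullet> i) * box_bump n c d x)"
      using cd box_bump_eq_0[of _ c d n] box_subset_cbox[of c d]
      by (intro Bochner_Integration.integral_cong refl) (auto split: split_indicator)
    ultimately show "(LINT x|lborel. ?u x * partial_deriv i (box_bump n c d) x)
        = - (LINT x|lborel. (?g x \<bullet> i) * box_bump n c d x)"
      using weak[OF _ i, of c d n] cd K(2) by simp
  qed (rule shift)
  then have "AE x in lborel. x \<in> box a b \<longrightarrow>
    u (x + h) - u x = (LINT t|lborel. indicator {0..1} t * (g (x + t *\<^sub>R h) \<bullet> h))"
  proof eventually_elim
    case (elim x)
    show ?case
    proof
      assume x: "x \<in> box a b"
      then have x': "x \<in> cbox a b" using box_subset_cbox by blast
      have "(\<lambda>t. indicator {0..1} t * (?g (x + t *\<^sub>R h) \<bullet> h))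
          = (\<lambda>t. indicator {0..1} t * (g (x + t *\<^sub>R h) \<bullet> h))"
        using shift[OF _ x'] by (auto simp: fun_eq_iff split: split_indicator)
      \<comment> \<open>\<open>shift\<close> at \<open>t = 0\<close> and \<open>t = 1\<close>
        removes the cut-off from \<open>u x\<close> and \<open>u (x + h)\<close>.\<close>
      then show "u (x + h) - u x = (LINT t|lborel. indicator {0..1} t * (g (x + t *\<^sub>R h) \<bullet> h))"
        using elim x shift[of 0, OF _ x'] shift[of 1, OF _ x'] by simp
    qed
  qed
  then show "\<exists>V. open V \<and> p \<in> V \<and> (AE x in lborel. x \<in> V \<longrightarrow>
    u (x + h) - u x = (LINT t|lborel. indicator {0..1} t * (g (x + t *\<^sub>R h) \<bullet> h)))"
    using ab(1) open_box by blast
qed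

text \<open>The exceptional null set of \<open>weak_FTC_AE\<close> depends on \<open>h\<close>. The
  joint condition is measurable, so Fubini interchanges the two almost-everywhere
  quantifiers.\<close>

lemma weak_FTC_AE_AE:
  fixes u :: "'a::euclidean_space \<Rightarrow> real" and g :: "'a \<Rightarrow> 'a"
  assumes \<Omega>: "open \<Omega>"
    and [measurable]: "u \<in> borel_measurable borel" "g \<in> borel_measurable borel"
    and u: "\<And>K. compact K \<Longrightarrow> K \<subseteq> \<Omega> \<Longrightarrow> set_integrable lborel K u"
    and g: "\<And>K. compact K \<Longrightarrow> K \<subseteq> \<Omega> \<Longrightarrow> set_integrable lborel K g"
    and weak: "\<And>c d n i. cbox c d \<subseteq> \<Omega> \<Longrightarrow> i \<in> Basis \<Longrightarrow>
      (LINT x|lborel. u x * partial_deriv i (box_bump n c d) x)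
        = - (LINT x|lborel. (g x \<bullet> i) * box_bump n c d x)"
  shows "AE x in lborel. AE h in lborel. x \<in> \<Omega> \<and> norm h < infdist x (frontier \<Omega>) \<longrightarrow>
    u (x + h) - u x = (LINT t|lborel. indicator {0..1} t * (g (x + t *\<^sub>R h) \<bullet> h))"
proof -
  have [measurable]: "\<Omega> \<in> sets borel" "(\<lambda>x. infdist x (frontier \<Omega>)) \<in> borel_measurable borel"
    using \<Omega> by (auto intro!: borel_measurable_continuous_onI continuous_intros)
  have "AE h in lborel. AE x in lborel. x \<in> \<Omega> \<and> norm h < infdist x (frontier \<Omega>) \<longrightarrow>
    u (x + h) - u x = (LINT t|lborel. indicator {0..1} t * (g (x + t *\<^sub>R h) \<bullet> h))"
  proof (rule always_eventually, rule allI)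
    fix h
    have "AE x in lborel. x \<in> {x. cball x (norm h) \<subseteq> \<Omega>} \<longrightarrow>
      u (x + h) - u x = (LINT t|lborel. indicator {0..1} t * (g (x + t *\<^sub>R h) \<bullet> h))"
      by (rule weak_FTC_AE[OF \<Omega> u g weak])
    then show "AE x in lborel. x \<in> \<Omega> \<and> norm h < infdist x (frontier \<Omega>) \<longrightarrow>
      u (x + h) - u x = (LINT t|lborel. indicator {0..1} t * (g (x + t *\<^sub>R h) \<bullet> h))"
      by eventually_elim (use cball_subset_if_infdist_frontier in auto)
  qed
  then show ?thesis
    by (subst lborel_pair.AE_commute) measurable
qed

text \<open>Cauchy-Schwarz against the indicator of the unit interval, whose square integrates to 1.
  With a right-hand side in \<open>ennreal\<close> no integrability has to be assumed: a
  nonintegrable function has Bochner integral 0.\<close>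

lemma norm_integral_segment_le:
  fixes g :: "real \<Rightarrow> 'a::euclidean_space"
  assumes [measurable]: "g \<in> borel_measurable borel"
  shows "ennreal ((LINT t|lborel. indicator {0..1} t * (g t \<bullet> h))\<^sup>2)
    \<le> ennreal ((norm h)\<^sup>2) * (\<integral>\<^sup>+t. indicator {0..1} t * ennreal ((norm (g t))\<^sup>2) \<partial>lborel)"
proof (cases "integrable lborel (\<lambda>t. indicator {0..1} t * (g t \<bullet> h))")
  case True
  have "ennreal ((LINT t|lborel. indicator {0..1} t * (g t \<bullet> h))\<^sup>2)
      = (ennreal (norm (LINT t|lborel. indicator {0..1} t * (g t \<bullet> h))))\<^sup>2"
    by (simp add: ennreal_power)
  also have "\<dots> \<le> (\<integral>\<^sup>+t. ennreal (norm (indicator {0..1} t * (g t \<bullet> h))) \<partial>lborel)\<^sup>2"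
    by (intro power_mono integral_norm_bound_ennreal True) simp
  \<comment> \<open>The indicator is idempotent; one copy is split off as the second factor for
    Cauchy-Schwarz.\<close>
  also have "\<dots> = (\<integral>\<^sup>+t. indicator {0..1} t * ennreal (indicator {0..1} t * \<bar>g t \<bullet> h\<bar>) \<partial>lborel)\<^sup>2"
    by (intro arg_cong[where f="\<lambda>x. x\<^sup>2"] nn_integral_cong) (auto split: split_indicator)
  also have "\<dots> \<le> (\<integral>\<^sup>+t. (indicator {0..1} t)\<^sup>2 \<partial>(lborel :: real measure))
      * (\<integral>\<^sup>+t. (ennreal (indicator {0..1} t * \<bar>g t \<bullet> h\<bar>))\<^sup>2 \<partial>lborel)"
    by (rule Cauchy_Schwarz_nn_integral) measurable
  also have "(\<integral>\<^sup>+t. (indicator {0..1} t)\<^sup>2 \<partial>(lborel :: real measure)) = (\<integral>\<^sup>+t. indicator {0..1} t \<partial>(lborel :: real measure))"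
    by (intro nn_integral_cong) (auto split: split_indicator)
  also have "\<dots> = 1" by simp
  also have "(\<integral>\<^sup>+t. (ennreal (indicator {0..1} t * \<bar>g t \<bullet> h\<bar>))\<^sup>2 \<partial>lborel)
      \<le> (\<integral>\<^sup>+t. ennreal ((norm h)\<^sup>2) * (indicator {0..1} t * ennreal ((norm (g t))\<^sup>2)) \<partial>lborel)"
  proof (rule nn_integral_mono)
    fix t :: real
    have "\<bar>g t \<bullet> h\<bar>\<^sup>2 \<le> (norm (g t) * norm h)\<^sup>2"
      by (intro power_mono Cauchy_Schwarz_ineq2) simp
    then show "(ennreal (indicator {0..1} t * \<bar>g t \<bullet> h\<bar>))\<^sup>2
        \<le> ennreal ((norm h)\<^sup>2) * (indicator {0..1} t * ennreal ((norm (g t))\<^sup>2))"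
      by (auto simp: ennreal_power power_mult_distrib mult.commute ennreal_leI
          simp flip: ennreal_mult split: split_indicator)
  qed
  also have "\<dots> = ennreal ((norm h)\<^sup>2) * (\<integral>\<^sup>+t. indicator {0..1} t * ennreal ((norm (g t))\<^sup>2) \<partial>lborel)"
    by (rule nn_integral_cmult) measurable
  finally show ?thesis by simp
qed (simp add: not_integrable_integral_eq)

section \<open>The nonlocal energy of Borel representatives\<close>

text \<open>All data are Borel, so that Tonelli and translation apply without further measurability
  arguments; the localization functions enter only through the inclusion of balls and the two
  comparison bounds.\<close>

lemma nonlocal_energy_le:
  fixes u \<eta> :: "'a::euclidean_space \<Rightarrow> real" and g :: "'a \<Rightarrow> 'a"
  assumes [measurable]: "\<Omega> \<in> sets borel" "u \<in> borel_measurable borel" "g \<in> borel_measurable borel"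
      "\<eta> \<in> borel_measurable borel"
    and R: "0 < R" "R < 1"
    and pos: "\<And>x. x \<in> \<Omega> \<Longrightarrow> 0 < \<eta> x"
    and ball: "\<And>x y. x \<in> \<Omega> \<Longrightarrow> norm (y - x) \<le> R * \<eta> x \<Longrightarrow> y \<in> \<Omega>"
    and comp1: "\<And>x y. x \<in> \<Omega> \<Longrightarrow> norm (y - x) \<le> R * \<eta> x \<Longrightarrow> \<eta> y \<le> 4/3 * \<eta> x"
    and comp2: "\<And>x y. x \<in> \<Omega> \<Longrightarrow> norm (y - x) \<le> R * \<eta> x \<Longrightarrow> \<eta> x \<le> 3/2 * \<eta> y"
    and FTC: "AE x in lborel. AE h in lborel. x \<in> \<Omega> \<and> norm h \<le> R * \<eta> x \<longrightarrow>
      u (x + h) - u x = (LINT t|lborel. indicator {0..1} t * (g (x + t *\<^sub>R h) \<bullet> h))"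
  shows "(\<integral>\<^sup>+x\<in>\<Omega>. (\<integral>\<^sup>+y\<in>\<Omega> \<inter> {y. norm (y - x) \<le> R * \<eta> x}.
       ennreal (\<bar>u x - u y\<bar>\<^sup>2 / \<eta> x ^ (DIM('a) + 2)) \<partial>lborel) \<partial>lborel)
     \<le> ennreal (2 ^ DIM('a) * unit_ball_vol (real DIM('a))) * (\<integral>\<^sup>+x\<in>\<Omega>. ennreal ((norm (g x))\<^sup>2) \<partial>lborel)"
proof -
  let ?n = "DIM('a)"
  \<comment> \<open>\<open>m\<close> bounds the integrand in terms of the intermediate point
    \<open>y = x + t *\<^sub>R h\<close> and \<open>h\<close> alone: \<open>comp1\<close> replaces
    the power of \<open>\<eta> x\<close> by one of \<open>\<eta> y\<close>, and \<open>comp2\<close>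
    turns the constraint on \<open>h\<close> into
    \<open>norm h \<le> 3/2 * \<eta> y\<close>.\<close>
  define m :: "'a \<Rightarrow> 'a \<Rightarrow> ennreal" where
    "m y h = indicator \<Omega> y * (if norm h \<le> 3/2 * \<eta> y then 1 else 0) *
       ennreal ((norm (g y))\<^sup>2 * ((4/3) ^ ?n / \<eta> y ^ ?n))" for y h
  have [measurable]: "(\<lambda>(y, h). m y h) \<in> borel_measurable (borel \<Otimes>\<^sub>M borel)"
    unfolding m_def by measurable
  have inner: "AE x in lborel. (\<integral>\<^sup>+y\<in>\<Omega> \<inter> {y. norm (y - x) \<le> R * \<eta> x}.
       ennreal (\<bar>u x - u y\<bar>\<^sup>2 / \<eta> x ^ (?n + 2)) \<partial>lborel) * indicator \<Omega> x
     \<le> (\<integral>\<^sup>+h. (\<integral>\<^sup>+t. indicator {0..1} t * m (x + t *\<^sub>R h) h \<partial>lborel) \<partial>lborel)"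
    using FTC
  proof eventually_elim
    case (elim x)
    show ?case
    proof (cases "x \<in> \<Omega>")
      case x: True
      let ?F = "\<lambda>y. ennreal (\<bar>u x - u y\<bar>\<^sup>2 / \<eta> x ^ (?n + 2)) * indicator (\<Omega> \<inter> {y. norm (y - x) \<le> R * \<eta> x}) y"
      have "(\<integral>\<^sup>+y. ?F y \<partial>lborel) = (\<integral>\<^sup>+h. ?F (h + x) \<partial>lborel)"
        by (rule nn_integral_lborel_translate[symmetric]) measurable
      also have "\<dots> \<le> (\<integral>\<^sup>+h. (\<integral>\<^sup>+t. indicator {0..1} t * m (x + t *\<^sub>R h) h \<partial>lborel) \<partial>lborel)"
        using elim
      proof (intro nn_integral_mono_AE, eventually_elim)
        case (elim h)
        show ?case
        proof (cases "norm h \<le> R * \<eta> x")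
          case h: True
          have "norm h \<le> \<eta> x"
            using h R pos[OF x] by (smt (verit) mult_le_cancel_right1)
          have "?F (h + x) = ennreal (1 / \<eta> x ^ (?n + 2)) * ennreal ((u (x + h) - u x)\<^sup>2)"
            using ball[OF x, of "h + x"] h pos[OF x]
            by (simp add: add.commute power2_commute flip: ennreal_mult)
          also have "(u (x + h) - u x)\<^sup>2 = (LINT t|lborel. indicator {0..1} t * (g (x + t *\<^sub>R h) \<bullet> h))\<^sup>2"
            using elim x h by simp
          also have "ennreal \<dots> \<le> ennreal ((norm h)\<^sup>2)
              * (\<integral>\<^sup>+t. indicator {0..1} t * ennreal ((norm (g (x + t *\<^sub>R h)))\<^sup>2) \<partial>lborel)"
            by (rule norm_integral_segment_le) measurable
          also have "\<dots> \<le> ennreal ((\<eta> x)\<^sup>2)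
              * (\<integral>\<^sup>+t. indicator {0..1} t * ennreal ((norm (g (x + t *\<^sub>R h)))\<^sup>2) \<partial>lborel)"
            using \<open>norm h \<le> \<eta> x\<close> by (intro mult_right_mono ennreal_leI power_mono) auto
          \<comment> \<open>The bound of \<open>(norm h)\<^sup>2\<close> by
            \<open>(\<eta> x)\<^sup>2\<close> absorbs the two extra powers in the
            denominator.\<close>
          also have "ennreal (1 / \<eta> x ^ (?n + 2)) * \<dots> = ennreal (1 / \<eta> x ^ ?n)
              * (\<integral>\<^sup>+t. indicator {0..1} t * ennreal ((norm (g (x + t *\<^sub>R h)))\<^sup>2) \<partial>lborel)"
            using pos[OF x] by (simp add: mult.assoc[symmetric] power_add power2_eq_square flip: ennreal_mult)
          also have "\<dots> = (\<integral>\<^sup>+t. ennreal (1 / \<eta> x ^ ?n) *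
              (indicator {0..1} t * ennreal ((norm (g (x + t *\<^sub>R h)))\<^sup>2)) \<partial>lborel)"
            by (rule nn_integral_cmult[symmetric]) measurable
          also have "\<dots> \<le> (\<integral>\<^sup>+t. indicator {0..1} t * m (x + t *\<^sub>R h) h \<partial>lborel)"
          proof (rule nn_integral_mono)
            fix t :: real
            show "ennreal (1 / \<eta> x ^ ?n) * (indicator {0..1} t * ennreal ((norm (g (x + t *\<^sub>R h)))\<^sup>2))
              \<le> indicator {0..1} t * m (x + t *\<^sub>R h) h"
            proof (cases "t \<in> {0..1}")
              case t: True
              define y where "y = x + t *\<^sub>R h"
              have "norm (y - x) \<le> norm h"
                using t by (simp add: y_def mult_left_le_one_le)
              then have yx: "norm (y - x) \<le> R * \<eta> x" using h by simp
              note y = ball[OF x yx] and c = comp1[OF x yx] comp2[OF x yx]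
              have "norm h \<le> 3/2 * \<eta> y" using \<open>norm h \<le> \<eta> x\<close> c by simp
              have "\<eta> y ^ ?n \<le> (4/3 * \<eta> x) ^ ?n"
                using c pos[OF y] by (intro power_mono) auto
              then have "1 / \<eta> x ^ ?n \<le> (4/3) ^ ?n / \<eta> y ^ ?n"
                using pos[OF y] pos[OF x] unfolding power_mult_distrib
                by (simp add: pos_divide_le_eq pos_le_divide_eq)
              then have "1 / \<eta> x ^ ?n * (norm (g y))\<^sup>2 \<le> (norm (g y))\<^sup>2 * ((4/3) ^ ?n / \<eta> y ^ ?n)"
                by (subst mult.commute) (rule mult_left_mono; simp)
              then show ?thesis
                using t y \<open>norm h \<le> 3/2 * \<eta> y\<close> pos[OF x]
                by (simp add: m_def ennreal_leI flip: y_def ennreal_mult)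
            qed simp
          qed
          finally show ?thesis by (simp add: mult_left_mono)
        qed simp
      qed
      finally show ?thesis using x by simp
    qed simp
  qed
  have m_int: "(\<integral>\<^sup>+h. m x h \<partial>lborel)
      = ennreal (2 ^ ?n * unit_ball_vol (real ?n)) * (ennreal ((norm (g x))\<^sup>2) * indicator \<Omega> x)" for x
  proof (cases "x \<in> \<Omega>")
    case True
    have "(\<integral>\<^sup>+h. m x h \<partial>lborel) = (\<integral>\<^sup>+h. ennreal ((norm (g x))\<^sup>2 * ((4/3) ^ ?n / \<eta> x ^ ?n))
        * indicator (cball (0::'a) (3/2 * \<eta> x)) h \<partial>lborel)"
      using True by (intro nn_integral_cong) (auto simp: m_def split: split_indicator)
    also have "\<dots> = ennreal ((norm (g x))\<^sup>2 * ((4/3) ^ ?n / \<eta> x ^ ?n))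
        * ennreal (unit_ball_vol (real ?n) * (3/2 * \<eta> x) ^ ?n)"
      using pos[OF True] by (subst nn_integral_cmult_indicator) (auto simp: emeasure_cball)
    also have "\<dots> = ennreal ((norm (g x))\<^sup>2 * ((4/3) ^ ?n / \<eta> x ^ ?n) * (unit_ball_vol (real ?n) * (3/2 * \<eta> x) ^ ?n))"
      using pos[OF True] by (intro ennreal_mult[symmetric]) auto
    \<comment> \<open>The powers of \<open>\<eta> x\<close> cancel, and \<open>4/3 * 3/2 = 2\<close>
      leaves the factor \<open>2 ^ ?n\<close>.\<close>
    also have "(norm (g x))\<^sup>2 * ((4/3) ^ ?n / \<eta> x ^ ?n) * (unit_ball_vol (real ?n) * (3/2 * \<eta> x) ^ ?n)
        = ((4/3) * (3/2)) ^ ?n * unit_ball_vol (real ?n) * (norm (g x))\<^sup>2"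
      unfolding power_mult_distrib using pos[OF True] by simp
    finally show ?thesis using True by (simp add: ennreal_mult)
  qed (simp add: m_def)
  have "(\<integral>\<^sup>+x\<in>\<Omega>. (\<integral>\<^sup>+y\<in>\<Omega> \<inter> {y. norm (y - x) \<le> R * \<eta> x}.
       ennreal (\<bar>u x - u y\<bar>\<^sup>2 / \<eta> x ^ (?n + 2)) \<partial>lborel) \<partial>lborel)
     \<le> (\<integral>\<^sup>+x. (\<integral>\<^sup>+h. (\<integral>\<^sup>+t. indicator {0..1} t * m (x + t *\<^sub>R h) h \<partial>lborel) \<partial>lborel) \<partial>lborel)"
    by (rule nn_integral_mono_AE[OF inner])
  \<comment> \<open>Two exchanges bring the integral over \<open>x\<close> inside. There
    \<open>h\<close> and \<open>t\<close> are fixed, and translation invariance removes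
    \<open>t\<close> from \<open>m (x + t *\<^sub>R h) h\<close>.\<close>
  also have "\<dots> = (\<integral>\<^sup>+h. (\<integral>\<^sup>+x. (\<integral>\<^sup>+t. indicator {0..1} t * m (x + t *\<^sub>R h) h \<partial>lborel) \<partial>lborel) \<partial>lborel)"
    by (rule lborel_pair.Fubini') measurable
  also have "\<dots> = (\<integral>\<^sup>+h. (\<integral>\<^sup>+t. (\<integral>\<^sup>+x. indicator {0..1} t * m (x + t *\<^sub>R h) h \<partial>lborel) \<partial>lborel) \<partial>lborel)"
    by (intro nn_integral_cong lborel_pair.Fubini') measurable
  also have "\<dots> = (\<integral>\<^sup>+h. (\<integral>\<^sup>+t. indicator {0..1} t * (\<integral>\<^sup>+x. m x h \<partial>lborel) \<partial>(lborel :: real measure)) \<partial>lborel)"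
  proof (intro nn_integral_cong)
    fix h :: 'a and t :: real
    have "(\<integral>\<^sup>+x. indicator {0..1} t * m (x + t *\<^sub>R h) h \<partial>lborel)
        = indicator {0..1} t * (\<integral>\<^sup>+x. m (x + t *\<^sub>R h) h \<partial>lborel)"
      by (rule nn_integral_cmult) measurable
    also have "(\<integral>\<^sup>+x. m (x + t *\<^sub>R h) h \<partial>lborel) = (\<integral>\<^sup>+x. m x h \<partial>lborel)"
      by (rule nn_integral_lborel_translate) measurable
    finally show "(\<integral>\<^sup>+x. indicator {0..1} t * m (x + t *\<^sub>R h) h \<partial>lborel)
        = indicator {0..1} t * (\<integral>\<^sup>+x. m x h \<partial>lborel)" .
  qed
  also have "\<dots> = (\<integral>\<^sup>+h. (\<integral>\<^sup>+x. m x h \<partial>lborel) \<partial>lborel)"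
    by (simp add: nn_integral_multc)
  also have "\<dots> = (\<integral>\<^sup>+x. (\<integral>\<^sup>+h. m x h \<partial>lborel) \<partial>lborel)"
    by (rule lborel_pair.Fubini') measurable
  also have "\<dots> = ennreal (2 ^ ?n * unit_ball_vol (real ?n)) * (\<integral>\<^sup>+x\<in>\<Omega>. ennreal ((norm (g x))\<^sup>2) \<partial>lborel)"
    unfolding m_int by (rule nn_integral_cmult) measurable
  finally show ?thesis .
qed

section \<open>Localization functions and the completed measure\<close>

lemma frechet_derivative_eq_grad_inner:
  assumes "f differentiable at x"
  shows "frechet_derivative f (at x) v = grad f x \<bullet> v"
proof -
  interpret bounded_linear "frechet_derivative f (at x)"
    using assms by (metis frechet_derivative_works has_derivative_bounded_linear)
  have "frechet_derivative f (at x) v = (\<Sum>i\<in>Basis. (v \<bullet> i) * frechet_derivative f (at x) i)"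
    by (subst euclidean_representation[of v, symmetric]) (simp only: sum scale real_scaleR_def)
  also have "\<dots> = grad f x \<bullet> v"
    by (simp add: grad_def partial_deriv_def inner_sum_right inner_commute[of _ v] mult.commute)
  finally show ?thesis .
qed

lemma Lipschitz_if_norm_grad_le:
  assumes "convex S" and diff: "\<And>x. x \<in> S \<Longrightarrow> f differentiable at x"
    and B: "\<And>x. x \<in> S \<Longrightarrow> norm (grad f x) \<le> B" and "x \<in> S" "y \<in> S"
  shows "\<bar>f x - f y\<bar> \<le> B * norm (x - y)"
proof -
  have "norm (f x - f y) \<le> B * norm (x - y)"
  proof (rule differentiable_bound[OF \<open>convex S\<close> _ _ \<open>x \<in> S\<close> \<open>y \<in> S\<close>])
    fix z assume z: "z \<in> S"
    show "(f has_derivative (\<lambda>v. grad f z \<bullet> v)) (at z within S)"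
      using diff[OF z] frechet_derivative_works[of f "at z"]
      by (simp add: frechet_derivative_eq_grad_inner[OF diff[OF z], abs_def] has_derivative_at_withinI)
    have "norm (grad f z \<bullet> v) \<le> B * norm v" for v
      using Cauchy_Schwarz_ineq2[of "grad f z" v] B[OF z]
      by (smt (verit) mult_right_mono norm_ge_zero real_norm_def)
    then show "onorm (\<lambda>v. grad f z \<bullet> v) \<le> B" by (rule onorm_le)
  qed
  then show ?thesis by simp
qed

text \<open>With \<open>d\<close> the distance to the frontier, the square of
  \<open>min \<delta> (d\<^sup>2)\<close> is at most \<open>\<delta> * d\<^sup>2\<close>. The upper
  bound on \<open>\<eta>\<close> and \<open>\<delta> < 1 / (2 * \<kappa>b\<^sub>0\<^sup>2)\<close>
  then make \<open>(\<eta> \<delta> x)\<^sup>2\<close> smaller than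
  \<open>d\<^sup>2\<close>.\<close>

lemma localization_family_less_infdist:
  assumes loc: "localization_family \<Omega> \<kappa>\<^sub>0 \<kappa>\<^sub>1 \<kappa>\<^sub>2 \<kappa>b\<^sub>0 \<eta>"
    and \<delta>: "0 < \<delta>" "\<delta> < delta0 \<kappa>\<^sub>1 \<kappa>b\<^sub>0" and "0 < \<kappa>b\<^sub>0" and x: "x \<in> \<Omega>"
  shows "\<eta> \<delta> x < infdist x (frontier \<Omega>)"
proof -
  let ?d = "infdist x (frontier \<Omega>)"
  have \<eta>: "0 < \<eta> \<delta> x" "\<eta> \<delta> x \<le> \<kappa>b\<^sub>0 * min \<delta> (?d\<^sup>2)"
    using loc \<delta> x unfolding localization_family_def by blast+
  have "\<delta> < 1 / (2 * \<kappa>b\<^sub>0\<^sup>2)" using \<delta>(2) by (simp add: delta0_def)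
  then have k: "\<kappa>b\<^sub>0\<^sup>2 * \<delta> < 1 / 2"
    using \<open>0 < \<kappa>b\<^sub>0\<close> by (simp add: field_simps)
  have "min \<delta> (?d\<^sup>2) * min \<delta> (?d\<^sup>2) \<le> \<delta> * ?d\<^sup>2"
    using \<delta> by (intro mult_mono) auto
  then have "\<kappa>b\<^sub>0\<^sup>2 * (min \<delta> (?d\<^sup>2))\<^sup>2 \<le> \<kappa>b\<^sub>0\<^sup>2 * (\<delta> * ?d\<^sup>2)"
    by (intro mult_left_mono) (auto simp: power2_eq_square)
  moreover have "(\<eta> \<delta> x)\<^sup>2 \<le> (\<kappa>b\<^sub>0 * min \<delta> (?d\<^sup>2))\<^sup>2"
    using \<eta> by (intro power_mono) auto
  ultimately have "(\<eta> \<delta> x)\<^sup>2 \<le> (\<kappa>b\<^sub>0\<^sup>2 * \<delta>) * ?d\<^sup>2"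
    by (simp add: power_mult_distrib mult.assoc)
  \<comment> \<open>A zero distance would force \<open>\<eta> \<delta> x \<le> 0\<close>, against
    positivity.\<close>
  moreover have "0 < ?d\<^sup>2"
    using \<eta> \<open>0 < \<kappa>b\<^sub>0\<close> \<delta> infdist_nonneg[of x "frontier \<Omega>"]
    by (cases "?d = 0") auto
  then have "(\<kappa>b\<^sub>0\<^sup>2 * \<delta>) * ?d\<^sup>2 < 1 * ?d\<^sup>2"
    using k by (intro mult_strict_right_mono) auto
  ultimately have "(\<eta> \<delta> x)\<^sup>2 < ?d\<^sup>2" by simp
  then show ?thesis
    by (rule power2_less_imp_less) (rule infdist_nonneg)
qed

text \<open>The bound \<open>\<delta> < 1 / (9 * \<kappa>\<^sub>1\<^sup>2)\<close> limits the slope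
  to 1/3. On the ball of radius \<open>\<eta> \<delta> x\<close>, which lies in \<Omega>, the
  function thus changes by at most a third of \<open>\<eta> \<delta> x\<close>, so its values lie
  between 2/3 and 4/3 of it.\<close>

lemma localization_family_comparable:
  assumes loc: "localization_family \<Omega> \<kappa>\<^sub>0 \<kappa>\<^sub>1 \<kappa>\<^sub>2 \<kappa>b\<^sub>0 \<eta>"
    and \<delta>: "0 < \<delta>" "\<delta> < delta0 \<kappa>\<^sub>1 \<kappa>b\<^sub>0" and \<kappa>: "0 < \<kappa>\<^sub>1" "0 < \<kappa>b\<^sub>0"
    and x: "x \<in> \<Omega>" and y: "norm (y - x) \<le> \<eta> \<delta> x"
  shows "y \<in> \<Omega>" "\<eta> \<delta> y \<le> 4/3 * \<eta> \<delta> x" "\<eta> \<delta> x \<le> 3/2 * \<eta> \<delta> y"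
proof -
  let ?B = "cball x (\<eta> \<delta> x)"
  have B: "?B \<subseteq> \<Omega>"
    by (rule cball_subset_if_infdist_frontier[OF x localization_family_less_infdist[OF loc \<delta> \<kappa>(2) x]])
  have yB: "y \<in> ?B" using y by (simp add: dist_norm norm_minus_commute)
  then show "y \<in> \<Omega>" using B by blast
  have "0 < \<eta> \<delta> x" "Ck_closure 2 \<Omega> (\<eta> \<delta>)"
    using loc \<delta> x unfolding localization_family_def by blast+
  then have diff: "\<And>z. z \<in> \<Omega> \<Longrightarrow> \<eta> \<delta> differentiable at z"
    by (simp add: numeral_2_eq_2)
  have "\<delta> < 1 / (9 * \<kappa>\<^sub>1\<^sup>2)" using \<delta>(2) by (simp add: delta0_def)
  then have "(\<kappa>\<^sub>1 * sqrt \<delta>)\<^sup>2 \<le> (1/3)\<^sup>2"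
    using \<kappa> \<delta> by (simp add: power_mult_distrib field_simps)
  then have k: "\<kappa>\<^sub>1 * sqrt \<delta> \<le> 1/3"
    by (rule power2_le_imp_le) simp
  have grad: "norm (grad (\<eta> \<delta>) z) \<le> 1/3" if "z \<in> \<Omega>" for z
  proof -
    have "norm (grad (\<eta> \<delta>) z) \<le> \<kappa>\<^sub>1 * sqrt \<delta>"
      using loc \<delta> that unfolding localization_family_def by blast
    then show ?thesis using k by linarith
  qed
  have "\<bar>\<eta> \<delta> y - \<eta> \<delta> x\<bar> \<le> 1/3 * norm (y - x)"
    using B diff grad yB \<open>0 < \<eta> \<delta> x\<close> by (intro Lipschitz_if_norm_grad_le[of ?B]) auto
  then show "\<eta> \<delta> y \<le> 4/3 * \<eta> \<delta> x" "\<eta> \<delta> x \<le> 3/2 * \<eta> \<delta> y"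
    using y by (auto simp: abs_if split: if_splits)
qed

section \<open>Borel representatives and the final estimate\<close>

lemma completion_ex_borel_measurable_euclidean:
  fixes f :: "'a \<Rightarrow> 'b::euclidean_space"
  assumes "f \<in> borel_measurable (completion M)"
  shows "\<exists>f'\<in>borel_measurable M. AE x in M. f x = f' x"
proof -
  have "\<exists>f'\<in>borel_measurable M. AE x in M. f x \<bullet> i = f' x" for i
    using assms by (intro completion_ex_borel_measurable_real) simp
  then obtain F where F: "\<And>i. F i \<in> borel_measurable M" "\<And>i. AE x in M. f x \<bullet> i = F i x"
    by metis
  have "AE x in M. \<forall>i\<in>Basis. f x \<bullet> i = F i x"
    using F(2) by (intro AE_finite_allI) auto
  then have "AE x in M. f x = (\<Sum>i\<in>Basis. F i x *\<^sub>R i)"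
    by eventually_elim (metis (no_types, lifting) euclidean_representation sum.cong)
  moreover have "(\<lambda>x. \<Sum>i\<in>Basis. F i x *\<^sub>R i) \<in> borel_measurable M"
    by (intro borel_measurable_sum borel_measurable_scaleR F(1)) simp
  ultimately show ?thesis by (intro bexI)
qed

text \<open>A compact exhaustion makes the extension by 0 a pointwise limit of Lebesgue measurable
  functions. It therefore has a Borel version, which inherits integrability on compact sets because
  the two differ only on a null set.\<close>

lemma locally_integrable_ex_borel:
  fixes f :: "'a::euclidean_space \<Rightarrow> 'b::euclidean_space"
  assumes \<Omega>: "open \<Omega>" and f: "locally_integrable \<Omega> f"
  obtains f' where "f' \<in> borel_measurable borel" "AE x in lborel. indicator \<Omega> x *\<^sub>R f x = f' x"
    "(\<lambda>x. indicator \<Omega> x *\<^sub>R f x) \<in> borel_measurable lebesgue"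
    "\<And>K. compact K \<Longrightarrow> K \<subseteq> \<Omega> \<Longrightarrow> set_integrable lborel K f'"
proof -
  obtain C :: "nat \<Rightarrow> 'a set" where C: "\<And>n. compact (C n)" "\<And>n. C n \<subseteq> \<Omega>"
    "\<And>n. C n \<subseteq> interior (C (Suc n))" "\<Union>(range C) = \<Omega>"
    using open_Union_compact_subsets[OF \<Omega>] by metis
  have inc: "incseq C"
    using C(3) interior_subset by (intro incseq_SucI) blast
  have meas: "(\<lambda>x. indicator \<Omega> x *\<^sub>R f x) \<in> borel_measurable lebesgue"
  proof (rule borel_measurable_LIMSEQ_metric)
    show "(\<lambda>x. indicator (C n) x *\<^sub>R f x) \<in> borel_measurable lebesgue" for n
      using f C(1,2)[of n] by (auto simp: locally_integrable_def set_integrable_def)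
    show "(\<lambda>n. indicator (C n) x *\<^sub>R f x) \<longlonglongrightarrow> indicator \<Omega> x *\<^sub>R f x" for x
      using LIMSEQ_indicator_incseq[OF inc, of x] unfolding C(4)
      by (intro tendsto_scaleR tendsto_const)
  qed
  then obtain f' where f': "f' \<in> borel_measurable lborel" "AE x in lborel. indicator \<Omega> x *\<^sub>R f x = f' x"
    using completion_ex_borel_measurable_euclidean by blast
  have "set_integrable lborel K f'" if K: "compact K" "K \<subseteq> \<Omega>" for K
  proof -
    have [measurable]: "K \<in> sets borel" using K by (simp add: borel_compact)
    have K': "(\<lambda>x. indicator K x *\<^sub>R f' x) \<in> borel_measurable lborel" using f'(1) by measurable
    have int: "integrable lebesgue (\<lambda>x. indicator K x *\<^sub>R f x)"
      using f K by (auto simp: locally_integrable_def set_integrable_def)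
    moreover have "AE x in lebesgue. indicator K x *\<^sub>R f x = indicator K x *\<^sub>R f' x"
      using AE_completion[OF f'(2)] by eventually_elim (use K in \<open>auto split: split_indicator\<close>)
    ultimately have "integrable lebesgue (\<lambda>x. indicator K x *\<^sub>R f' x)"
      using K' integrable_cong_AE[of "\<lambda>x. indicator K x *\<^sub>R f x" lebesgue "\<lambda>x. indicator K x *\<^sub>R f' x"]
      by (simp add: borel_measurable_integrable measurable_completion)
    then show ?thesis
      using K' by (simp add: set_integrable_def integrable_completion)
  qed
  then show thesis using that[of f'] f' meas by simp
qed

lemma ennsqrt_le_mult_if:
  assumes "a \<le> ennreal c * b" "0 < c"
  shows "ennsqrt a \<le> ennreal (sqrt c) * ennsqrt b"
proof (cases "b = \<infinity>")
  case True
  then show ?thesis using assms by (simp add: ennsqrt_def ennreal_mult_top)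
next
  case False
  then obtain s where s: "b = ennreal s" "0 \<le> s" by (cases b) auto
  then have "a \<le> ennreal (c * s)" using assms by (simp add: ennreal_mult)
  then obtain r where r: "a = ennreal r" "0 \<le> r" "r \<le> c * s"
    using assms s by (cases a) (auto simp: ennreal_le_iff top_unique)
  then have "sqrt r \<le> sqrt c * sqrt s" by (simp flip: real_sqrt_mult)
  then show ?thesis
    using r s assms by (simp add: ennsqrt_def ennreal_leI flip: ennreal_mult)
qed

text \<open>Box bumps are test functions, and neither the Borel versions nor the passage from
  \<open>lebesgue\<close> to \<open>lborel\<close> changes the integrals.\<close>

lemma weak_gradient_box_bump:
  fixes u :: "'a::euclidean_space \<Rightarrow> real" and g :: "'a \<Rightarrow> 'a"
  assumes wg: "weak_gradient \<Omega> u g"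
    and u': "u' \<in> borel_measurable borel" "AE x in lborel. indicator \<Omega> x *\<^sub>R u x = u' x"
      "(\<lambda>x. indicator \<Omega> x *\<^sub>R u x) \<in> borel_measurable lebesgue"
    and g': "g' \<in> borel_measurable borel" "AE x in lborel. indicator \<Omega> x *\<^sub>R g x = g' x"
      "(\<lambda>x. indicator \<Omega> x *\<^sub>R g x) \<in> borel_measurable lebesgue"
    and cd: "cbox c d \<subseteq> \<Omega>" and i: "i \<in> Basis"
  shows "(LINT x|lborel. u' x * partial_deriv i (box_bump n c d) x)
        = - (LINT x|lborel. (g' x \<bullet> i) * box_bump n c d x)"
proof -
  \<comment> \<open>Used twice: with a partial derivative of the bump for \<open>u\<close>, and with
    the bump itself for the components of \<open>g\<close>.\<close>
  have eq: "(LINT x:\<Omega>|lebesgue. v x * \<psi> x) = (LINT x|lborel. v' x * \<psi> x)"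
    if v': "v' \<in> borel_measurable borel" "AE x in lborel. indicator \<Omega> x * v x = v' x"
      "(\<lambda>x. indicator \<Omega> x * v x) \<in> borel_measurable lebesgue" and \<psi>: "bump_algebra \<psi>" for v v' \<psi>
  proof -
    have \<psi>' [measurable]: "\<psi> \<in> borel_measurable borel"
      using \<psi> by (intro borel_measurable_continuous_onI bump_algebra_continuous)
    have [measurable]: "v' \<in> borel_measurable borel" by fact
    have b: "(\<lambda>x. v' x * \<psi> x) \<in> borel_measurable lborel" by measurable
    have "(LINT x:\<Omega>|lebesgue. v x * \<psi> x) = (LINT x|lebesgue. (indicator \<Omega> x * v x) * \<psi> x)"
      by (simp add: set_lebesgue_integral_def mult.assoc)
    also have "\<dots> = (LINT x|lebesgue. v' x * \<psi> x)"
    proof (rule integral_cong_AE)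
      have "\<psi> \<in> borel_measurable lebesgue" using \<psi>' by (intro measurable_completion) simp
      then show "(\<lambda>x. indicator \<Omega> x * v x * \<psi> x) \<in> borel_measurable lebesgue"
        by (intro borel_measurable_times v'(3))
      show "(\<lambda>x. v' x * \<psi> x) \<in> borel_measurable lebesgue"
        by (intro measurable_completion b)
      show "AE x in lebesgue. indicator \<Omega> x * v x * \<psi> x = v' x * \<psi> x"
        using AE_completion[OF v'(2)] by eventually_elim simp
    qed
    also have "\<dots> = (LINT x|lborel. v' x * \<psi> x)"
      by (rule integral_completion[OF b])
    finally show ?thesis .
  qed
  have 1: "(LINT x:\<Omega>|lebesgue. u x * partial_deriv i (box_bump n c d) x)
      = (LINT x|lborel. u' x * partial_deriv i (box_bump n c d) x)"
    using u' by (intro eq bump_algebra_partial_deriv bump_algebra_box_bump) auto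
  have 2: "(LINT x:\<Omega>|lebesgue. (g x \<bullet> i) * box_bump n c d x) = (LINT x|lborel. (g' x \<bullet> i) * box_bump n c d x)"
  proof (rule eq[OF _ _ _ bump_algebra_box_bump])
    show "(\<lambda>x. g' x \<bullet> i) \<in> borel_measurable borel" using g'(1) by measurable
    show "AE x in lborel. indicator \<Omega> x * (g x \<bullet> i) = g' x \<bullet> i"
      using g'(2) by eventually_elim (metis inner_scaleR_left)
    show "(\<lambda>x. indicator \<Omega> x * (g x \<bullet> i)) \<in> borel_measurable lebesgue"
      using borel_measurable_inner[OF g'(3) borel_measurable_const[of i]] by simp
  qed
  show ?thesis
    using wg box_bump_test_function[OF cd, of n] i unfolding weak_gradient_def 1[symmetric] 2[symmetric] by blast
qed

text \<open>Transfers the estimate from Borel versions back to \<open>u\<close> and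
  \<open>g\<close>; the constant depends on the dimension only.\<close>

lemma W_seminorm_le:
  fixes \<Omega> :: "'a::euclidean_space set"
  assumes \<Omega>: "open \<Omega>" and loc: "localization_family \<Omega> \<kappa>\<^sub>0 \<kappa>\<^sub>1 \<kappa>\<^sub>2 \<kappa>b\<^sub>0 \<eta>"
    and \<kappa>: "0 < \<kappa>\<^sub>1" "0 < \<kappa>b\<^sub>0" and R: "0 < R" "R < 1"
    and \<delta>: "0 < \<delta>" "\<delta> < delta0 \<kappa>\<^sub>1 \<kappa>b\<^sub>0"
    and wg: "weak_gradient \<Omega> u g"
  shows "W_seminorm \<Omega> R (\<eta> \<delta>) u
    \<le> ennreal (sqrt (2 ^ DIM('a) * unit_ball_vol (real DIM('a)))) * L2norm \<Omega> g"
proof -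
  have [measurable]: "\<Omega> \<in> sets borel" using \<Omega> by simp
  have loc_int: "locally_integrable \<Omega> u" "locally_integrable \<Omega> g"
    using wg by (auto simp: weak_gradient_def)
  obtain u' where u': "u' \<in> borel_measurable borel" "AE x in lborel. indicator \<Omega> x *\<^sub>R u x = u' x"
    "(\<lambda>x. indicator \<Omega> x *\<^sub>R u x) \<in> borel_measurable lebesgue"
    "\<And>K. compact K \<Longrightarrow> K \<subseteq> \<Omega> \<Longrightarrow> set_integrable lborel K u'"
    using locally_integrable_ex_borel[OF \<Omega> loc_int(1)] by blast
  obtain g' where g': "g' \<in> borel_measurable borel" "AE x in lborel. indicator \<Omega> x *\<^sub>R g x = g' x"
    "(\<lambda>x. indicator \<Omega> x *\<^sub>R g x) \<in> borel_measurable lebesgue"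
    "\<And>K. compact K \<Longrightarrow> K \<subseteq> \<Omega> \<Longrightarrow> set_integrable lborel K g'"
    using locally_integrable_ex_borel[OF \<Omega> loc_int(2)] by blast
  \<comment> \<open>Continuity of \<open>\<eta> \<delta>\<close> is known only on
    \<open>closure \<Omega>\<close>; cutting off to \<Omega> yields a Borel function on the whole
    space.\<close>
  define e where "e x = indicator \<Omega> x * \<eta> \<delta> x" for x
  have e [simp]: "e x = \<eta> \<delta> x" if "x \<in> \<Omega>" for x using that by (simp add: e_def)
  have e_meas: "e \<in> borel_measurable borel"
  proof -
    have "continuous_on (closure \<Omega>) (\<eta> \<delta>)"
      using loc \<delta> unfolding localization_family_def by blast
    then have "continuous_on \<Omega> (\<eta> \<delta>)"
      using closure_subset continuous_on_subset by blast
    then show ?thesis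
      using borel_measurable_continuous_on_indicator[of \<Omega> "\<eta> \<delta>"]
      by (simp add: e_def[abs_def])
  qed
  have e_pos: "0 < e x" if "x \<in> \<Omega>" for x
    using loc \<delta> that unfolding localization_family_def by simp
  have comp: "y \<in> \<Omega>" "e y \<le> 4/3 * e x" "e x \<le> 3/2 * e y"
    if x: "x \<in> \<Omega>" and y: "norm (y - x) \<le> R * e x" for x y
  proof -
    have "R * e x \<le> e x" using R e_pos[OF x] by simp
    then have "norm (y - x) \<le> \<eta> \<delta> x" using x y by simp
    note c = localization_family_comparable[OF loc \<delta> \<kappa> x this]
    show "y \<in> \<Omega>" "e y \<le> 4/3 * e x" "e x \<le> 3/2 * e y" using c x by auto
  qed
  have "AE x in lborel. AE h in lborel. x \<in> \<Omega> \<and> norm h < infdist x (frontier \<Omega>) \<longrightarrow>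
    u' (x + h) - u' x = (LINT t|lborel. indicator {0..1} t * (g' (x + t *\<^sub>R h) \<bullet> h))"
    using weak_gradient_box_bump[OF wg u'(1-3) g'(1-3)]
    by (intro weak_FTC_AE_AE[OF \<Omega> u'(1) g'(1) u'(4) g'(4)])
  then have FTC: "AE x in lborel. AE h in lborel. x \<in> \<Omega> \<and> norm h \<le> R * e x \<longrightarrow>
    u' (x + h) - u' x = (LINT t|lborel. indicator {0..1} t * (g' (x + t *\<^sub>R h) \<bullet> h))"
  proof eventually_elim
    case (elim x)
    have "R * e x < infdist x (frontier \<Omega>)" if "x \<in> \<Omega>"
    proof -
      have "R * e x \<le> e x" using R e_pos[OF that] by simp
      then show ?thesis
        using localization_family_less_infdist[OF loc \<delta> \<kappa>(2) that] that by simp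
    qed
    then show ?case using elim by (auto elim!: eventually_mono)
  qed
  have "(\<integral>\<^sup>+x\<in>\<Omega>. (\<integral>\<^sup>+y\<in>\<Omega> \<inter> {y. norm (y - x) \<le> R * \<eta> \<delta> x}.
       ennreal (\<bar>u x - u y\<bar>\<^sup>2 / \<eta> \<delta> x ^ (DIM('a) + 2)) \<partial>lebesgue) \<partial>lebesgue)
     = (\<integral>\<^sup>+x\<in>\<Omega>. (\<integral>\<^sup>+y\<in>\<Omega> \<inter> {y. norm (y - x) \<le> R * e x}.
       ennreal (\<bar>u' x - u' y\<bar>\<^sup>2 / e x ^ (DIM('a) + 2)) \<partial>lborel) \<partial>lborel)"
    unfolding nn_integral_completion
  \<comment> \<open>The null set where \<open>u\<close> and \<open>u'\<close> differ on \<Omega> is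
    discarded twice, for \<open>x\<close> outside and for \<open>y\<close> inside.\<close>
  proof (rule nn_integral_cong_AE, use u'(2) in eventually_elim)
    case (elim x)
    show ?case
    proof (cases "x \<in> \<Omega>")
      case True
      have "(\<integral>\<^sup>+y\<in>\<Omega> \<inter> {y. norm (y - x) \<le> R * \<eta> \<delta> x}.
          ennreal (\<bar>u x - u y\<bar>\<^sup>2 / \<eta> \<delta> x ^ (DIM('a) + 2)) \<partial>lborel)
        = (\<integral>\<^sup>+y\<in>\<Omega> \<inter> {y. norm (y - x) \<le> R * e x}.
          ennreal (\<bar>u' x - u' y\<bar>\<^sup>2 / e x ^ (DIM('a) + 2)) \<partial>lborel)"
      proof (rule nn_integral_cong_AE, use u'(2) in eventually_elim)
        case y: (elim y)
        then show ?case using True elim by (auto split: split_indicator)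
      qed
      then show ?thesis by simp
    qed simp
  qed
  also have "\<dots> \<le> ennreal (2 ^ DIM('a) * unit_ball_vol (real DIM('a)))
      * (\<integral>\<^sup>+x\<in>\<Omega>. ennreal ((norm (g' x))\<^sup>2) \<partial>lborel)"
    by (rule nonlocal_energy_le[OF _ u'(1) g'(1) e_meas R e_pos comp FTC]) auto
  also have "(\<integral>\<^sup>+x\<in>\<Omega>. ennreal ((norm (g' x))\<^sup>2) \<partial>lborel) = (\<integral>\<^sup>+x\<in>\<Omega>. ennreal ((norm (g x))\<^sup>2) \<partial>lebesgue)"
    unfolding nn_integral_completion
    by (rule nn_integral_cong_AE, use g'(2) in eventually_elim) (auto split: split_indicator)
  finally show ?thesis
    unfolding W_seminorm_def L2norm_def by (rule ennsqrt_le_mult_if) simp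
qed

theorem theorem1p5:
  fixes \<Omega> :: "'a::euclidean_space set"
    and \<kappa>\<^sub>0 \<kappa>\<^sub>1 \<kappa>\<^sub>2 \<kappa>b\<^sub>0 R :: real
  assumes "bounded_C2_domain \<Omega>"
    and "0 < \<kappa>\<^sub>0" and "\<kappa>\<^sub>0 < 1" and "0 < \<kappa>\<^sub>1" and "0 < \<kappa>\<^sub>2" and "0 < \<kappa>b\<^sub>0"
    and "0 < R" and "R < 1"
  shows "\<exists>C::real. 0 < C \<and>
    (\<forall>(\<eta> :: real \<Rightarrow> 'a \<Rightarrow> real) (\<rho> :: real \<Rightarrow> real).
       localization_family \<Omega> \<kappa>\<^sub>0 \<kappa>\<^sub>1 \<kappa>\<^sub>2 \<kappa>b\<^sub>0 \<eta> \<longrightarrow>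
       admissible_kernel \<rho> \<longrightarrow> normalized_kernel TYPE('a) \<rho> \<longrightarrow>
       (\<forall>\<delta>. 0 < \<delta> \<and> \<delta> < delta0 \<kappa>\<^sub>1 \<kappa>b\<^sub>0 \<longrightarrow>
          (\<forall>u\<in>H1_space \<Omega>. \<forall>g. weak_gradient \<Omega> u g \<longrightarrow>
             W_seminorm \<Omega> R (\<eta> \<delta>) u \<le> ennreal C * L2norm \<Omega> g)))"
\<comment> \<open>The root appears because the energy is the square of the seminorm. The witness
  involves neither \<open>\<eta>\<close> nor \<open>\<delta>\<close>, hence is uniform in
  both.\<close>
proof (intro exI[of _ "sqrt (2 ^ DIM('a) * unit_ball_vol (real DIM('a)))"] conjI allI impI ballI)
  show "0 < sqrt (2 ^ DIM('a) * unit_ball_vol (real DIM('a)))" by simp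
next
  fix \<eta> :: "real \<Rightarrow> 'a \<Rightarrow> real" and \<delta> u g
  assume loc: "localization_family \<Omega> \<kappa>\<^sub>0 \<kappa>\<^sub>1 \<kappa>\<^sub>2 \<kappa>b\<^sub>0 \<eta>"
    and \<delta>: "0 < \<delta> \<and> \<delta> < delta0 \<kappa>\<^sub>1 \<kappa>b\<^sub>0" and wg: "weak_gradient \<Omega> u g"
  have "open \<Omega>" using assms(1) by (simp add: bounded_C2_domain_def)
  from W_seminorm_le[OF this loc assms(4,6,7,8) _ _ wg] \<delta>
  show "W_seminorm \<Omega> R (\<eta> \<delta>) u
      \<le> ennreal (sqrt (2 ^ DIM('a) * unit_ball_vol (real DIM('a)))) * L2norm \<Omega> g"
    by blast
qed

end
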